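(* Let $\Theta=(\theta_1,\dots,\theta_m)\in(\mathbb R/2\pi\mathbb Z)^m$ have pairwise distinct phases, let $F=(F_n)_{n\ge0}$ be a complex sequence with $\sum_{n\ge0}|F_n|r^n<\infty$ for $0<r<1$, and let $\mathcal F(z)=\sum_{n\ge0}F_nz^n$. Suppose that for each $j$, near $\zeta_j=e^{-i\theta_j}$, a meromorphic continuation agreeing with the power series inside the unit disc has the form $$\mathcal F(z)=\frac{a_j}{1-e^{i\theta_j}z}+H_j(z)$$ with $a_j\in\mathbb C$ and $H_j$ holomorphic near $\zeta_j$. Then $A_\infty^d(F)\ge q_\Theta(a)$, where $a=(a_1,\dots,a_m)$. If $R_j$ is the residue of the continuation at $\zeta_j$, then $a_j=-e^{i\theta_j}R_j$.
   Context: $A_\infty^d(F)=\lim_{N\to\infty}\sup_{n\ge N}|F_n|\in[0,\infty]$. With $\Psi_\Theta(n)=(e^{in\theta_1},\dots,e^{in\theta_m})$, let $G_\Theta=\overline{\Psi_\Theta(\mathbb Z)}\subseteq\mathbb T^m$ (a compact group) with Haar probability measure $m_\Theta$ and restricted coordinate characters $\chi_j(z)=z_j$. Then $$q_\Theta(a)=\inf\Bigl\{\|f\|_{L^\infty(G_\Theta)}:\ f\in L^\infty(G_\Theta),\ \int_{G_\Theta}f\overline{\chi_j}\,dm_\Theta=a_j\ (1\le j\le m)\Bigr\}.$$ *)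

theory Defs
  imports
    "HOL-Probability.Probability"
    "HOL-Complex_Analysis.Complex_Analysis"
    "HOL-Library.Real_Mod"
begin

definition A_infty_d :: "(nat \<Rightarrow> complex) \<Rightarrow> ereal" where
  "A_infty_d F = limsup (\<lambda>n. ereal (norm (F n)))"

text \<open>The phases in \<open>(\<real>/2\<pi>\<int>)\<^sup>m\<close> are given by real representatives; everything below
  depends on them only modulo \<open>2\<pi>\<close>. Multiplication on \<open>complex ^ 'm\<close> is componentwise,
  so it restricts to the group law of the torus.\<close>

definition Psi :: "real ^ 'm \<Rightarrow> int \<Rightarrow> complex ^ 'm" where
  "Psi \<Theta> n = (\<chi> j. exp (\<i> * of_int n * of_real (\<Theta> $ j)))"

definition G :: "real ^ 'm \<Rightarrow> (complex ^ 'm) set" where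
  "G \<Theta> = closure (range (Psi \<Theta>))"

definition is_haar_prob :: "('a::{topological_space, times}) set \<Rightarrow> 'a measure \<Rightarrow> bool" where
  "is_haar_prob K M \<longleftrightarrow>
     prob_space M \<and> sets M = sets (restrict_space borel K) \<and>
     (\<forall>g\<in>K. distr M M (\<lambda>z. g * z) = M)"

text \<open>On a compact metrizable group there is exactly one such measure (every finite Borel measure
  on it is regular), so the choice operator below is immaterial.\<close>

definition haar_prob :: "('a::{topological_space, times}) set \<Rightarrow> 'a measure" where
  "haar_prob K = (SOME M. is_haar_prob K M)"

definition Linf_norm :: "'a measure \<Rightarrow> ('a \<Rightarrow> complex) \<Rightarrow> ereal" where
  "Linf_norm M f = esssup M (\<lambda>x. ereal (norm (f x)))"

definition Linf :: "'a measure \<Rightarrow> ('a \<Rightarrow> complex) set" where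
  "Linf M = {f \<in> borel_measurable M. Linf_norm M f < \<infinity>}"

definition q :: "real ^ 'm \<Rightarrow> complex ^ 'm \<Rightarrow> ereal" where
  "q \<Theta> a = Inf {Linf_norm (haar_prob (G \<Theta>)) f | f.
      f \<in> Linf (haar_prob (G \<Theta>)) \<and>
      (\<forall>j. (LINT z|haar_prob (G \<Theta>). f z * cnj (z $ j)) = a $ j)}"

end

theory Submission
  imports
    Defs
    "HOL-Analysis.Kronecker_Approximation_Theorem"
begin

text \<open>
  Near \<open>\<zeta>\<^sub>j\<close> the power series is \<open>a\<^sub>j / (1 - z / \<zeta>\<^sub>j)\<close> up to a holomorphic term, so radial approach
  shows that the Abel means \<open>(1 - r) \<Sum> r\<^sup>n F\<^sub>n \<zeta>\<^sub>j\<^sup>n\<close> tend to \<open>a\<^sub>j\<close> as \<open>r \<rightarrow> 1\<close>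
  (\<open>abel_mean_tendsto_pole_coefficient\<close>). Pairing with a vector \<open>c\<close>, the real number \<open>c \<bullet> a\<close> is the limit of Abel means of
  \<open>Re (F\<^sub>n (Q (\<Psi> n))\<^sup>*)\<close> with the trigonometric sum \<open>Q z = \<Sum> c\<^sub>j z\<^sub>j\<close>. If \<open>\<bar>F\<^sub>n\<bar> \<le> B'\<close> for all
  large \<open>n\<close>, these are asymptotically at most \<open>B'\<close> times the Abel means of \<open>\<bar>Q (\<Psi> n)\<bar>\<close>, and the orbit
  \<open>\<Psi> n\<close> is equidistributed in its closure (\<open>abel_mean_tendsto_haar_integral\<close>). Hence
  \<open>c \<bullet> a \<le> B' \<parallel>Q\<parallel>\<^sub>1\<close> for all \<open>c\<close>, which by duality between \<open>L\<^sup>1\<close> and \<open>L\<^sup>\<infinity>\<close>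
  (\<open>q_le_if_dual_bound\<close>) means that the infimum \<open>q\<close> does not exceed any \<open>B > B'\<close>.
  Distinctness of the phases makes the characters orthonormal, so that \<open>\<parallel>Q\<parallel>\<^sub>1 > 0\<close> whenever \<open>c \<noteq> 0\<close>, and \<open>B' \<parallel>Q\<parallel>\<^sub>1 < B \<parallel>Q\<parallel>\<^sub>1\<close>.

  Since the Haar measure is obtained by a choice operator, all of this rests on its existence, which is
  established by structure rather than by general theory (\<open>admits_haar_G\<close>). Writing the phases in a rational basis
  that contains \<open>1\<close> presents the orbit as an orbit in a torus times a finite cyclic group, and Kronecker's
  approximation theorem shows that it is dense there. So the orbit closure is the product of
  closed one-parameter subgroups and a finite cyclic subgroup, and the image of the product of uniform measures is invariant.
\<close>

text \<open>Throughout, \<open>$\<close> selects a coordinate of a vector, never a coefficient of a formal power series.\<close>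

no_notation fps_nth (infixl \<open>$\<close> 75)

section \<open>Points of the torus\<close>

definition torus_pt :: "('m \<Rightarrow> real) \<Rightarrow> complex ^ 'm" where
  "torus_pt x = (\<chi> j. cis (2 * pi * x j))"

lemma torus_pt_add: "torus_pt (\<lambda>j. x j + y j) = torus_pt x * torus_pt y"
  by (simp add: torus_pt_def vec_eq_iff cis_mult distrib_left)

lemma torus_pt_Ints:
  assumes "\<And>j. k j \<in> \<int>" shows "torus_pt k = 1"
  using assms by (simp add: torus_pt_def vec_eq_iff cis_multiple_2pi)

lemma torus_pt_cong_Ints:
  assumes "\<And>j. x j - y j \<in> \<int>" shows "torus_pt x = torus_pt y"
  using torus_pt_add[of "\<lambda>j. x j - y j" y] torus_pt_Ints[of "\<lambda>j. x j - y j"] assms by simp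

lemma tendsto_torus_pt:
  assumes "\<And>j. ((\<lambda>i. x i j) \<longlongrightarrow> y j) L"
  shows "((\<lambda>i. torus_pt (x i)) \<longlongrightarrow> torus_pt y) L"
  unfolding torus_pt_def cis_conv_exp by (intro tendsto_vec_lambda tendsto_intros assms)

lemma Psi_eq_torus_pt: "Psi \<Theta> n = torus_pt (\<lambda>j. of_int n * (\<Theta> $ j / (2 * pi)))"
  by (simp add: Psi_def torus_pt_def vec_eq_iff cis_conv_exp mult_ac)

lemma continuous_on_vec_mult:
  fixes f g :: "'a::topological_space \<Rightarrow> complex ^ 'm"
  assumes "continuous_on A f" "continuous_on A g"
  shows "continuous_on A (\<lambda>x. f x * g x)"
  unfolding times_vec_def
  by (intro continuous_on_vec_lambda continuous_intros assms)

lemma measurable_vec_mult: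
  "(\<lambda>(x, y). x * y) \<in> (borel :: (complex ^ 'm) measure) \<Otimes>\<^sub>M borel \<rightarrow>\<^sub>M borel"
  unfolding borel_prod split_beta
  by (intro borel_measurable_continuous_onI continuous_on_vec_mult continuous_intros)

section \<open>Invariant measures on products of subgroups\<close>

text \<open>A nonempty compact subsemigroup of the torus is a group, so closure under multiplication is the
  whole algebraic content of being a compact subgroup.\<close>

definition admits_haar :: "(complex ^ 'm) set \<Rightarrow> bool" where
  "admits_haar S \<longleftrightarrow> compact S \<and> (\<forall>x\<in>S. \<forall>y\<in>S. x * y \<in> S) \<and> (\<exists>M. is_haar_prob S M)"

lemma measurable_translation:
  fixes g :: "complex ^ 'm"
  assumes "sets M = sets (restrict_space borel S)" "\<forall>x\<in>S. \<forall>y\<in>S. x * y \<in> S" "g \<in> S"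
  shows "(\<lambda>z. g * z) \<in> M \<rightarrow>\<^sub>M M"
proof -
  have "(\<lambda>z. g * z) \<in> restrict_space borel S \<rightarrow>\<^sub>M restrict_space borel S"
    using assms(2,3) by (intro measurable_restrict_space3 borel_measurable_continuous_onI
       continuous_on_vec_mult continuous_intros) auto
  then show ?thesis
    using measurable_cong_sets[OF assms(1) assms(1)] by simp
qed

text \<open>The product of independent Haar elements of \<open>S\<close> and of \<open>T\<close> is Haar on \<open>ST\<close>: because multiplication is
  commutative, translating the product by \<open>g\<^sub>1 g\<^sub>2\<close> amounts to translating the factors by \<open>g\<^sub>1\<close>
  and \<open>g\<^sub>2\<close> separately, and this preserves the product measure. The two groups may intersect.\<close>

lemma admits_haar_product:
  fixes S T :: "(complex ^ 'm) set"
  assumes S: "admits_haar S" and T: "admits_haar T"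
  shows "admits_haar {x * y | x y. x \<in> S \<and> y \<in> T}" (is "admits_haar ?P")
proof -
  obtain M N where M: "is_haar_prob S M" and N: "is_haar_prob T N"
    using S T by (auto simp: admits_haar_def)
  interpret M: prob_space M using M by (simp add: is_haar_prob_def)
  interpret N: prob_space N using N by (simp add: is_haar_prob_def)
  interpret MN: pair_prob_space M N ..
  let ?R = "restrict_space borel ?P" and ?mult = "\<lambda>(x, y). x * y :: complex ^ 'm"
  have sM: "sets M = sets (restrict_space borel S)" and sN: "sets N = sets (restrict_space borel T)"
    using M N by (auto simp: is_haar_prob_def)
  have cS: "\<forall>x\<in>S. \<forall>y\<in>S. x * y \<in> S" and cT: "\<forall>x\<in>T. \<forall>y\<in>T. x * y \<in> T"
    using S T by (auto simp: admits_haar_def)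
  have spM: "space M = S" and spN: "space N = T"
    using sets_eq_imp_space_eq[OF sM] sets_eq_imp_space_eq[OF sN] by (simp_all add: space_restrict_space)
  have idM: "(\<lambda>x. x) \<in> M \<rightarrow>\<^sub>M borel" and idN: "(\<lambda>x. x) \<in> N \<rightarrow>\<^sub>M borel"
    unfolding measurable_cong_sets[OF sM refl] measurable_cong_sets[OF sN refl]
    by (rule measurable_restrict_space1, simp)+
  have "(\<lambda>p. (\<lambda>(x,y). x * y) (fst p, snd p)) \<in> M \<Otimes>\<^sub>M N \<rightarrow>\<^sub>M borel"
    by (intro measurable_compose[OF _ measurable_vec_mult] measurable_Pair
         measurable_compose[OF measurable_fst idM] measurable_compose[OF measurable_snd idN])
  then have mult: "?mult \<in> M \<Otimes>\<^sub>M N \<rightarrow>\<^sub>M ?R"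
    by (intro measurable_restrict_space2) (auto simp: space_pair_measure spM spN)
  have closed: "\<forall>x\<in>?P. \<forall>y\<in>?P. x * y \<in> ?P"
  proof clarify
    fix x y x' y' assume "x \<in> S" "y \<in> T" "x' \<in> S" "y' \<in> T"
    moreover have "x * y * (x' * y') = (x * x') * (y * y')" by (simp add: mult_ac)
    ultimately show "\<exists>xa ya. x * y * (x' * y') = xa * ya \<and> xa \<in> S \<and> ya \<in> T"
      using cS cT by blast
  qed
  let ?L = "distr (M \<Otimes>\<^sub>M N) ?R ?mult"
  have "distr ?L ?L (\<lambda>z. g * z) = ?L" if gP: "g \<in> ?P" for g
  proof -
    obtain g1 g2 where g: "g = g1 * g2" "g1 \<in> S" "g2 \<in> T" using gP by blast
    note t1 = measurable_translation[OF sM cS g(2)] and t2 = measurable_translation[OF sN cT g(3)]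
    have d1: "distr M M (\<lambda>z. g1 * z) = M" and d2: "distr N N (\<lambda>z. g2 * z) = N"
      using M N g by (auto simp: is_haar_prob_def)
    have t: "(\<lambda>z. g * z) \<in> ?R \<rightarrow>\<^sub>M ?R"
      by (rule measurable_translation[OF refl closed gP])
    have t12: "(\<lambda>(x, y). (g1 * x, g2 * y)) \<in> M \<Otimes>\<^sub>M N \<rightarrow>\<^sub>M M \<Otimes>\<^sub>M N"
      using t1 t2 by simp
    have "distr ?L ?L (\<lambda>z. g * z) = distr ?L ?R (\<lambda>z. g * z)"
      by (intro distr_cong) auto
    also have "\<dots> = distr (M \<Otimes>\<^sub>M N) ?R ((\<lambda>z. g * z) \<circ> ?mult)"
      by (rule distr_distr[OF t mult])
    also have "(\<lambda>z. g * z) \<circ> ?mult = ?mult \<circ> (\<lambda>(x, y). (g1 * x, g2 * y))"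
      by (auto simp: g mult_ac)
    also have "distr (M \<Otimes>\<^sub>M N) ?R \<dots> =
        distr (distr (M \<Otimes>\<^sub>M N) (M \<Otimes>\<^sub>M N) (\<lambda>(x, y). (g1 * x, g2 * y))) ?R ?mult"
      by (rule distr_distr[OF mult t12, symmetric])
    also have "distr (M \<Otimes>\<^sub>M N) (M \<Otimes>\<^sub>M N) (\<lambda>(x, y). (g1 * x, g2 * y)) = M \<Otimes>\<^sub>M N"
      using pair_measure_distr[OF t1 t2] d1 d2 N.sigma_finite_measure_axioms by simp
    finally show ?thesis .
  qed
  moreover have "prob_space ?L"
    by (rule MN.prob_space_distr[OF mult])
  ultimately have "is_haar_prob ?P ?L" by (simp add: is_haar_prob_def)
  moreover have "compact ?P"
  proof -
    have "?P = ?mult ` (S \<times> T)" by auto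
    moreover have "compact (?mult ` (S \<times> T))"
      unfolding split_beta using S T
      by (intro compact_continuous_image continuous_on_vec_mult continuous_intros compact_Times)
         (auto simp: admits_haar_def)
    ultimately show ?thesis by simp
  qed
  ultimately show ?thesis
    using closed by (auto simp: admits_haar_def)
qed

text \<open>Normalised counting measure works: with invertible coordinates, translations are injective and
  hence permute the finite set.\<close>

lemma admits_haar_finite:
  fixes S :: "(complex ^ 'm) set"
  assumes "finite S" "S \<noteq> {}" "\<And>x y. x \<in> S \<Longrightarrow> y \<in> S \<Longrightarrow> x * y \<in> S"
    and unit: "\<And>x j. x \<in> S \<Longrightarrow> x $ j \<noteq> 0"
  shows "admits_haar S"
proof -
  let ?p = "pmf_of_set S" and ?R = "restrict_space borel S"
  \<comment> \<open>The uniform distribution lives on the whole type; sending the null set of points outside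
    \<open>S\<close> to some element of \<open>S\<close> makes it a measure on the subspace.\<close>
  let ?M = "distr (measure_pmf ?p) ?R (\<lambda>x. if x \<in> S then x else (SOME x. x \<in> S))"
  let ?r = "\<lambda>x. if x \<in> S then x else (SOME x. x \<in> S)"
  have some: "(SOME x. x \<in> S) \<in> S" using assms(2) by (simp add: some_in_eq)
  have r: "?r \<in> measure_pmf ?p \<rightarrow>\<^sub>M ?R"
    using some by (intro measurable_restrict_space2) auto
  have "distr ?M ?M (\<lambda>z. g * z) = ?M" if g: "g \<in> S" for g
  proof -
    have inj: "inj_on (\<lambda>z. g * z) S"
      using unit[OF g] by (auto simp: inj_on_def vec_eq_iff)
    have im: "(\<lambda>z. g * z) ` S = S"
      using assms g by (intro endo_inj_surj inj) auto
    have t: "(\<lambda>z. g * z) \<in> ?R \<rightarrow>\<^sub>M ?R"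
      using assms g by (intro measurable_translation[OF refl]) auto
    have "distr ?M ?M (\<lambda>z. g * z) = distr ?M ?R (\<lambda>z. g * z)"
      by (intro distr_cong) auto
    also have "\<dots> = distr (measure_pmf ?p) ?R ((\<lambda>z. g * z) \<circ> ?r)"
      by (rule distr_distr[OF t r])
    also have "\<dots> = distr (measure_pmf ?p) ?R (?r \<circ> (\<lambda>z. g * z))"
    proof (rule distr_cong_AE)
      show "AE x in measure_pmf ?p. ((\<lambda>z. g * z) \<circ> ?r) x = (?r \<circ> (\<lambda>z. g * z)) x"
        using assms(1-3) g by (simp add: AE_measure_pmf_iff set_pmf_of_set)
      show "(\<lambda>z. g * z) \<circ> ?r \<in> measure_pmf ?p \<rightarrow>\<^sub>M ?R"
        by (rule measurable_comp[OF r t])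
      have "?r \<in> count_space UNIV \<rightarrow>\<^sub>M ?R"
        using r by simp
      then show "?r \<circ> (\<lambda>z. g * z) \<in> measure_pmf ?p \<rightarrow>\<^sub>M ?R"
        by (auto simp: Pi_iff)
    qed simp_all
    also have "\<dots> = distr (distr (measure_pmf ?p) (measure_pmf ?p) (\<lambda>z. g * z)) ?R ?r"
      by (rule distr_distr[symmetric, OF r]) simp
    also have "distr (measure_pmf ?p) (measure_pmf ?p) (\<lambda>z. g * z) = measure_pmf (map_pmf (\<lambda>z. g * z) ?p)"
      unfolding map_pmf_rep_eq by (intro distr_cong) auto
    also have "map_pmf (\<lambda>z. g * z) ?p = ?p"
      using map_pmf_of_set_inj[OF inj assms(2,1)] im by simp
    finally show ?thesis .
  qed
  moreover have "prob_space ?M"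
    by (rule measure_pmf.prob_space_distr[OF r])
  ultimately have "is_haar_prob S ?M" by (simp add: is_haar_prob_def)
  then show ?thesis using assms by (auto simp: admits_haar_def finite_imp_compact)
qed

text \<open>Only the fractional part \<open>s\<close> of \<open>\<tau>\<close> matters. The shifted window \<open>[s, 1 + s)\<close> is cut at \<open>1\<close>, and
  by periodicity its right-hand piece has the measure of \<open>E\<close> in \<open>[0, s)\<close>.\<close>

lemma emeasure_periodic_shift:
  fixes E :: "real set"
  assumes E[measurable]: "E \<in> sets borel" and per: "\<And>t. t + 1 \<in> E \<longleftrightarrow> t \<in> E"
  shows "emeasure lborel {t \<in> {0..<1}. t + \<tau> \<in> E} = emeasure lborel {t \<in> {0..<1}. t \<in> E}"
proof -
  have shift: "emeasure lborel {t. t + s \<in> A} = emeasure lborel A" if [measurable]: "A \<in> sets borel" for s and A :: "real set"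
  proof -
    have "emeasure lborel A = emeasure (distr lborel borel ((+) s)) A"
      by (simp add: lborel_distr_plus)
    also have "\<dots> = emeasure lborel ((+) s -` A \<inter> space lborel)"
      by (rule emeasure_distr) auto
    also have "(+) s -` A \<inter> space lborel = {t. t + s \<in> A}" by (auto simp: add_ac)
    finally show ?thesis ..
  qed
  have perN: "t + of_int n \<in> E \<longleftrightarrow> t \<in> E" for t and n :: int
  proof (induction n rule: int_induct[where k = 0])
    case (step1 i)
    then show ?case using per[of "t + of_int i"] by (simp add: add_ac)
  next
    case (step2 i)
    then show ?case using per[of "t + of_int (i - 1)"] by (simp add: add_ac)
  qed simp
  define s where "s = frac \<tau>"
  have s: "0 \<le> s" "s < 1" by (auto simp: s_def frac_lt_1)
  have "{t \<in> {0..<1}. t + \<tau> \<in> E} = {t. t + s \<in> {s..<1 + s} \<inter> E}"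
    using perN[of "t + s" "\<lfloor>\<tau>\<rfloor>" for t] by (auto simp: s_def frac_def)
  then have "emeasure lborel {t \<in> {0..<1}. t + \<tau> \<in> E} = emeasure lborel ({s..<1 + s} \<inter> E)"
    using shift[of "{s..<1 + s} \<inter> E" s] by simp
  also have "{s..<1 + s} \<inter> E = ({s..<1} \<inter> E) \<union> ({1..<1+s} \<inter> E)"
    using s by auto
  also have "emeasure lborel \<dots> = emeasure lborel ({s..<1} \<inter> E) + emeasure lborel ({1..<1+s} \<inter> E)"
    by (rule plus_emeasure[symmetric]) auto
  also have "emeasure lborel ({1..<1+s} \<inter> E) = emeasure lborel {t. t + 1 \<in> {1..<1+s} \<inter> E}"
    by (rule shift[symmetric]) auto
  also have "{t. t + 1 \<in> {1..<1+s} \<inter> E} = {0..<s} \<inter> E"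
    using per by auto
  also have "emeasure lborel ({s..<1} \<inter> E) + emeasure lborel ({0..<s} \<inter> E) = emeasure lborel (({s..<1} \<inter> E) \<union> ({0..<s} \<inter> E))"
    by (rule plus_emeasure) auto
  also have "({s..<1} \<inter> E) \<union> ({0..<s} \<inter> E) = {t \<in> {0..<1}. t \<in> E}"
    using s by auto
  finally show ?thesis .
qed

text \<open>A closed one-parameter subgroup carries the image of the uniform distribution on \<open>[0, 1)\<close>.
  Translations of the subgroup lift to shifts of the parameter modulo \<open>1\<close>.\<close>

lemma admits_haar_circle:
  fixes n :: "'m::finite \<Rightarrow> int"
  shows "admits_haar (range (\<lambda>t::real. torus_pt (\<lambda>j. of_int (n j) * t)))" (is "admits_haar (range ?c)")
proof -
  have add: "?c (s + t) = ?c s * ?c t" for s t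
    by (simp add: torus_pt_add distrib_left)
  have per: "?c (t + 1) = ?c t" for t
    by (rule torus_pt_cong_Ints) (simp add: algebra_simps)
  have cont: "continuous_on A ?c" for A
    unfolding continuous_on_def by (intro ballI tendsto_torus_pt tendsto_intros)
  have closed: "\<forall>x\<in>range ?c. \<forall>y\<in>range ?c. x * y \<in> range ?c"
    unfolding add[symmetric] ball_simps by (auto simp flip: add)
  have "range ?c = ?c ` {0..1}"
  proof -
    have "?c t = ?c (frac t)" for t
      by (rule torus_pt_cong_Ints) (simp add: frac_def algebra_simps)
    moreover have "frac t \<in> {0..1}" for t :: real by (auto simp: frac_lt_1 less_imp_le)
    ultimately have "?c t \<in> ?c ` {0..1}" for t by (rule image_eqI)
    then show ?thesis by blast
  qed
  then have compact: "compact (range ?c)"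
    using compact_continuous_image[OF cont, of "{0..1}"] by simp
  let ?U = "uniform_measure lborel {0..<1::real}" and ?R = "restrict_space borel (range ?c)"
  let ?M = "distr ?U ?R ?c"
  interpret U: prob_space ?U by (rule prob_space_uniform_measure) auto
  have c_borel [measurable]: "?c \<in> borel_measurable borel"
    by (rule borel_measurable_continuous_onI[OF cont])
  have c: "?c \<in> ?U \<rightarrow>\<^sub>M ?R"
    by (intro measurable_restrict_space2) auto
  have "distr ?M ?M (\<lambda>z. g * z) = ?M" if g: "g \<in> range ?c" for g
  proof -
    obtain \<tau> where \<tau>: "g = ?c \<tau>" using g by auto
    have t: "(\<lambda>z. g * z) \<in> ?R \<rightarrow>\<^sub>M ?R"
      by (rule measurable_translation[OF refl closed g])
    have ct: "(\<lambda>t. ?c (t + \<tau>)) \<in> ?U \<rightarrow>\<^sub>M ?R"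
      by (intro measurable_restrict_space2) auto
    have "distr ?M ?M (\<lambda>z. g * z) = distr ?M ?R (\<lambda>z. g * z)"
      by (intro distr_cong) auto
    also have "\<dots> = distr ?U ?R ((\<lambda>z. g * z) \<circ> ?c)"
      by (rule distr_distr[OF t c])
    also have "(\<lambda>z. g * z) \<circ> ?c = (\<lambda>t. ?c (t + \<tau>))"
      unfolding \<tau> comp_def add by (simp only: mult.commute)
    also have "distr ?U ?R (\<lambda>t. ?c (t + \<tau>)) = ?M"
    proof (rule measure_eqI)
      fix A assume "A \<in> sets (distr ?U ?R (\<lambda>t. ?c (t + \<tau>)))"
      then have A: "A \<in> sets ?R" by simp
      then obtain A' where A': "A' \<in> sets borel" "A = range ?c \<inter> A'"
        by (auto simp: sets_restrict_space)
      have "?c -` A = ?c -` A'" by (auto simp: A')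
      then have E: "?c -` A \<in> sets borel"
        using measurable_sets[OF c_borel A'(1)] by simp
      have E': "(\<lambda>t. ?c (t + \<tau>)) -` A \<in> sets borel"
        using measurable_sets[OF ct A] by simp
      have "emeasure (distr ?U ?R (\<lambda>t. ?c (t + \<tau>))) A
          = emeasure lborel ({0..<1} \<inter> (\<lambda>t. ?c (t + \<tau>)) -` A)"
        using E' by (simp add: emeasure_distr[OF ct A] divide_ennreal_def)
      also have "{0..<1} \<inter> (\<lambda>t. ?c (t + \<tau>)) -` A = {t \<in> {0..<1}. t + \<tau> \<in> ?c -` A}"
        by auto
      also have "emeasure lborel \<dots> = emeasure lborel {t \<in> {0..<1}. t \<in> ?c -` A}"
        by (rule emeasure_periodic_shift[OF E]) (simp only: vimage_eq per)
      also have "{t \<in> {0..<1}. t \<in> ?c -` A} = {0..<1} \<inter> ?c -` A" by auto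
      also have "emeasure lborel \<dots> = emeasure ?M A"
        using E by (simp add: emeasure_distr[OF c A] divide_ennreal_def)
      finally show "emeasure (distr ?U ?R (\<lambda>t. ?c (t + \<tau>))) A = emeasure ?M A" .
    qed simp
    finally show ?thesis .
  qed
  moreover have "prob_space ?M"
    by (rule U.prob_space_distr[OF c])
  ultimately have "is_haar_prob (range ?c) ?M" by (simp add: is_haar_prob_def)
  then show ?thesis
    using closed compact by (auto simp: admits_haar_def)
qed


section \<open>The orbit closure as a torus times a cyclic group\<close>

lemma int_independent_if_rat_independent:
  assumes "module.independent (\<lambda>(r::rat) x. of_rat r * (x::real)) B"
  shows "module.independent (\<lambda>(r::int) x. of_int r * (x::real)) B"
proof -
  interpret R: Modules.module "\<lambda>(r::rat) x. of_rat r * (x::real)"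
    by (simp add: Modules.module.intro distrib_left distrib_right of_rat_add of_rat_mult)
  interpret I: Modules.module "\<lambda>(r::int) x. of_int r * (x::real)"
    by (simp add: Modules.module.intro distrib_left distrib_right)
  show ?thesis
    unfolding I.independent_explicit_module
  proof (intro allI impI)
    fix t and u :: "real \<Rightarrow> int" and v
    assume "finite t" "t \<subseteq> B" "(\<Sum>v\<in>t. of_int (u v) * v) = 0" "v \<in> t"
    then show "u v = 0"
      using R.independentD[OF assms, of t "\<lambda>v. of_int (u v)" v] by simp
  qed
qed

text \<open>Extend \<open>{1}\<close> to a \<open>\<rat>\<close>-basis \<open>B\<close> of the span of \<open>X \<union> {1}\<close> and let \<open>N\<close> be a common denominator of
  the finitely many coordinates. Keeping \<open>1\<close> in the basis separates the torsion of the group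
  generated by the \<open>exp (2 \<pi> i x)\<close> (the coordinate at \<open>1\<close>) from its free part.\<close>

lemma finite_reals_rational_basis:
  fixes X :: "real set"
  assumes X: "finite X"
  obtains B :: "real set" and N :: int and n :: "real \<Rightarrow> real \<Rightarrow> int"
  where "finite B" "1 \<in> B" "N > 0"
    "module.independent (\<lambda>(r::int) x. of_int r * (x::real)) B"
    "\<And>x. x \<in> X \<Longrightarrow> of_int N * x = (\<Sum>b\<in>B. of_int (n x b) * b)"
proof -
  interpret R: Vector_Spaces.vector_space "\<lambda>(r::rat) x. of_rat r * (x::real)"
    by (simp add: Vector_Spaces.vector_space.intro distrib_left distrib_right of_rat_add of_rat_mult)
  have "R.independent {1}" by (simp add: R.dependent_single)
  then obtain B where B: "{1} \<subseteq> B" "B \<subseteq> insert 1 X" "R.independent B" "insert 1 X \<subseteq> R.span B"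
    using R.maximal_independent_subset_extend[of "{1}" "insert 1 X"] by auto
  have finB: "finite B" using B(2) X by (meson finite_insert finite_subset)
  have "\<exists>u. x = (\<Sum>b\<in>B. of_rat (u b) * b)" if "x \<in> X" for x
    using B(4) that R.span_finite[OF finB] by auto
  then obtain u :: "real \<Rightarrow> real \<Rightarrow> rat" where u: "\<And>x. x \<in> X \<Longrightarrow> x = (\<Sum>b\<in>B. of_rat (u x b) * b)"
    by metis
  define den where "den = (\<lambda>p. snd (quotient_of (u (fst p) (snd p))))"
  define N where "N = (\<Prod>p\<in>X \<times> B. den p)"
  have den: "den p > 0" for p by (simp add: den_def quotient_of_denom_pos')
  have "\<exists>k::int. of_int N * u x b = of_int k" if "x \<in> X" "b \<in> B" for x b
  proof -
    have "den (x, b) dvd N"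
      unfolding N_def using X finB that by (intro dvd_prodI) auto
    then obtain l where "N = den (x, b) * l" by (auto simp: dvd_def)
    moreover have "u x b = of_int (fst (quotient_of (u x b))) / of_int (den (x, b))"
      by (simp add: den_def quotient_of_div)
    ultimately have "of_int N * u x b = of_int (fst (quotient_of (u x b)) * l)"
      using den[of "(x, b)"] by (simp add: field_simps)
    then show ?thesis by blast
  qed
  then obtain n :: "real \<Rightarrow> real \<Rightarrow> int" where n: "\<And>x b. x \<in> X \<Longrightarrow> b \<in> B \<Longrightarrow> of_int N * u x b = of_int (n x b)"
    by metis
  show thesis
  proof (rule that[OF finB])
    show "1 \<in> B" using B by auto
    show "N > 0" unfolding N_def by (intro prod_pos) (simp add: den)
    show "module.independent (\<lambda>(r::int) x. of_int r * (x::real)) B"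
      by (rule int_independent_if_rat_independent[OF B(3)])
    fix x assume x: "x \<in> X"
    have "of_int N * x = (\<Sum>b\<in>B. of_int N * (of_rat (u x b) * b))"
      by (subst u[OF x]) (simp add: sum_distrib_left)
    also have "\<dots> = (\<Sum>b\<in>B. of_int (n x b) * b)"
    proof (rule sum.cong)
      fix b assume b: "b \<in> B"
      have "(of_int (n x b) :: real) = of_rat (of_int N * u x b)"
        by (simp add: n[OF x b])
      then show "of_int N * (of_rat (u x b) * b) = of_int (n x b) * b"
        by (simp add: of_rat_mult)
    qed simp
    finally show "of_int N * x = (\<Sum>b\<in>B. of_int (n x b) * b)" .
  qed
qed

text \<open>Reindexes Kronecker's theorem, so that it applies to a rational basis without an enumeration.\<close>

lemma Kronecker_finite_set:
  fixes B :: "real set" and \<alpha> :: "real \<Rightarrow> real"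
  assumes B: "finite B" "1 \<in> B" and ind: "module.independent (\<lambda>(r::int) x. of_int r * (x::real)) B" and "\<epsilon> > 0"
  obtains k :: int and m :: "real \<Rightarrow> int" where "\<And>b. b \<in> B - {1} \<Longrightarrow> \<bar>of_int k * b - of_int (m b) - \<alpha> b\<bar> < \<epsilon>"
proof -
  obtain e where e: "bij_betw e {..<card (B - {1})} (B - {1})"
    using ex_bij_betw_nat_finite[of "B - {1}"] B by (auto simp: atLeast0LessThan)
  define d where "d = card (B - {1})"
  define e' where "e' = e(d := 1)"
  have im: "e ` {..<d} = B - {1}" and inj: "inj_on e {..<d}"
    using e by (auto simp: bij_betw_def d_def)
  have ran: "e' ` {..d} = B"
  proof -
    have "e' ` {..d} = insert 1 (e' ` {..<d})" by (auto simp: e'_def lessThan_Suc_atMost[symmetric] less_Suc_eq)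
    also have "e' ` {..<d} = e ` {..<d}" by (auto simp: e'_def)
    finally show ?thesis using im B by auto
  qed
  have "inj_on e' {..d}"
    by (rule eq_card_imp_inj_on) (use ran B card_gt_0_iff[of B] in \<open>auto simp: d_def\<close>)
  then obtain k m where km: "\<And>i. i < d \<Longrightarrow> \<bar>of_int k * e' i - of_int (m i) - \<alpha> (e' i)\<bar> < \<epsilon>"
    using Kronecker_thm_2[of e' d \<epsilon> "\<lambda>i. \<alpha> (e' i)"] ran ind \<open>\<epsilon> > 0\<close> by (auto simp: e'_def)
  show thesis
  proof (rule that[of k "\<lambda>b. m (the_inv_into {..<d} e b)"])
    fix b assume "b \<in> B - {1}"
    then obtain i where i: "i < d" "b = e i" using im by blast
    then show "\<bar>of_int k * b - of_int (m (the_inv_into {..<d} e b)) - \<alpha> b\<bar> < \<epsilon>"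
      using km[OF i(1)] the_inv_into_f_f[OF inj, of i] by (simp add: e'_def)
  qed
qed

text \<open>The set is a product of a finite cyclic group (parameter \<open>s\<close>) and one closed one-parameter
  subgroup for each element of \<open>D\<close>, so the invariant measure is built one factor at a time.\<close>

lemma admits_haar_torus_times_cyclic:
  fixes p :: "'m::finite \<Rightarrow> int" and n :: "'m \<Rightarrow> 'b \<Rightarrow> int" and N :: int
  assumes "finite D" "N > 0"
  shows "admits_haar (range (\<lambda>(s::int, t :: 'b \<Rightarrow> real).
    torus_pt (\<lambda>j. of_int (p j) * (of_int s / of_int N) + (\<Sum>b\<in>D. of_int (n j b) * t b))))"
    (is "admits_haar (?S D)")
  using assms(1)
proof induction
  case empty
  let ?c = "\<lambda>s::int. torus_pt (\<lambda>j. of_int (p j) * (of_int s / of_int N))"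
  have S: "?S {} = range ?c" by auto
  have add: "?c (s + t) = ?c s * ?c t" for s t
    by (simp add: torus_pt_add distrib_left add_divide_distrib)
  have "range ?c = ?c ` {0..<N}"
  proof -
    have "?c s = ?c (s mod N)" for s
    proof (rule torus_pt_cong_Ints)
      fix j
      have "real_of_int s = of_int N * of_int (s div N) + of_int (s mod N)"
        by (simp flip: of_int_mult of_int_add)
      then have "real_of_int s / of_int N - of_int (s mod N) / of_int N = of_int (s div N)"
        using assms(2) by (simp add: field_simps)
      then have "of_int (p j) * (of_int s / of_int N) - of_int (p j) * (real_of_int (s mod N) / of_int N)
         = of_int (p j * (s div N))"
        by (simp only: right_diff_distrib[symmetric] of_int_mult)
      then show "of_int (p j) * (of_int s / of_int N) - of_int (p j) * (real_of_int (s mod N) / of_int N) \<in> \<int>"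
        by (metis Ints_of_int)
    qed
    moreover have "s mod N \<in> {0..<N}" for s using assms(2) by simp
    ultimately have "?c s \<in> ?c ` {0..<N}" for s by (rule image_eqI)
    then show ?thesis by blast
  qed
  then have "finite (range ?c)" by simp
  then show ?case
    unfolding S
  proof (rule admits_haar_finite)
    fix x y assume "x \<in> range ?c" "y \<in> range ?c"
    then obtain s t where "x = ?c s" "y = ?c t" by auto
    then have "x * y = ?c (s + t)" by (simp only: add)
    then show "x * y \<in> range ?c" by blast
  qed (auto simp: torus_pt_def)
next
  case (insert b D)
  let ?f = "\<lambda>D (s::int, t :: 'b \<Rightarrow> real). torus_pt (\<lambda>j. of_int (p j) * (of_int s / of_int N) + (\<Sum>b\<in>D. of_int (n j b) * t b))"
  let ?c = "\<lambda>t. torus_pt (\<lambda>j. of_int (n j b) * t)"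
  have eq: "?f (insert b D) (s, t) = ?f D (s, t) * ?c (t b)" for s t
    using insert.hyps by (simp add: algebra_simps flip: torus_pt_add)
  have "?S (insert b D) = {x * y | x y. x \<in> ?S D \<and> y \<in> range ?c}" (is "_ = ?P")
  proof
    show "?S (insert b D) \<subseteq> ?P" using eq by fastforce
    show "?P \<subseteq> ?S (insert b D)"
    proof
      fix z assume "z \<in> ?P"
      then obtain x y where "z = ?f D x * ?c y" by blast
      then obtain s t where z: "z = ?f D (s, t) * ?c y" by (cases x) blast
      have "(\<Sum>b'\<in>D. of_int (n j b') * (t(b := y)) b') = (\<Sum>b'\<in>D. of_int (n j b') * t b')" for j
        using insert.hyps by (intro sum.cong) auto
      then have "?f D (s, t(b := y)) = ?f D (s, t)" by (simp only: split)
      then have "?f D (s, t) * ?c y = ?f (insert b D) (s, t(b := y))"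
        using eq[of s "t(b := y)"] by simp
      then show "z \<in> ?S (insert b D)" unfolding z by (metis rangeI)
    qed
  qed
  then show ?case
    using admits_haar_product[OF insert.IH admits_haar_circle] by simp
qed

text \<open>In the coordinates of the rational basis, \<open>\<Psi>(k)\<close> has the parameters \<open>s = k\<close> and \<open>t\<^sub>b = k b / N\<close>,
  so the orbit lies in the parametrised group. Conversely, the orbit is dense there: restricted to
  times \<open>k = s + N l\<close>, which fix the cyclic component, the other parameters move by \<open>l b\<close>, and
  Kronecker's theorem for the independent numbers \<open>b\<close> and \<open>1\<close> lets them approach any target modulo
  integers.\<close>

lemma G_eq_torus_times_cyclic:
  fixes \<Theta> :: "real ^ 'm"
  assumes B: "finite B" "1 \<in> B" and N: "N > 0"
    and ind: "module.independent (\<lambda>(r::int) x. of_int r * (x::real)) B"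
    and \<Theta>: "\<And>j. of_int N * (\<Theta> $ j / (2 * pi)) = (\<Sum>b\<in>B. of_int (n j b) * b)"
    and S: "compact S" "S = range (\<lambda>(s::int, t).
      torus_pt (\<lambda>j. of_int (n j 1) * (of_int s / of_int N) + (\<Sum>b\<in>B - {1}. of_int (n j b) * t b)))"
  shows "G \<Theta> = S"
proof -
  let ?f = "\<lambda>s t. torus_pt (\<lambda>j. of_int (n j 1) * (of_int s / of_int N) + (\<Sum>b\<in>B - {1}. of_int (n j b) * t b)) :: complex ^ 'm"
  have Psi: "Psi \<Theta> k = ?f k (\<lambda>b. of_int k * (b / of_int N))" for k
  proof -
    have "of_int k * (\<Theta> $ j / (2 * pi)) = of_int (n j 1) * (of_int k / of_int N)
      + (\<Sum>b\<in>B - {1}. of_int (n j b) * (of_int k * (b / of_int N)))" for j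
    proof -
      have "of_int k * (\<Theta> $ j / (2 * pi)) = of_int k / of_int N * (\<Sum>b\<in>B. of_int (n j b) * b)"
        using N by (simp flip: \<Theta>)
      also have "\<dots> = (\<Sum>b\<in>B. of_int (n j b) * (of_int k * (b / of_int N)))"
        by (simp add: sum_distrib_left mult_ac)
      also have "\<dots> = of_int (n j 1) * (of_int k / of_int N)
      + (\<Sum>b\<in>B - {1}. of_int (n j b) * (of_int k * (b / of_int N)))"
        using B by (subst sum.remove[of _ 1]) auto
      finally show ?thesis .
    qed
    then show ?thesis unfolding Psi_eq_torus_pt by simp
  qed
  have "range (Psi \<Theta>) \<subseteq> S"
  proof clarify
    fix k show "Psi \<Theta> k \<in> S"
      unfolding Psi S(2) by (rule range_eqI[of _ _ "(k, \<lambda>b. of_int k * (b / of_int N))"]) simp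
  qed
  then have "G \<Theta> \<subseteq> S"
    unfolding G_def by (intro closure_minimal compact_imp_closed S)
  moreover have "?f s t \<in> G \<Theta>" for s t
  proof -
    \<comment> \<open>The target for \<open>l b\<close> is the wanted parameter minus the contribution of the residue \<open>s\<close>.\<close>
    have "\<exists>k m. \<forall>b\<in>B - {1}. \<bar>of_int k * b - of_int (m b) - (t b - of_int s * (b / of_int N))\<bar> < 1 / Suc i" for i
      by (rule Kronecker_finite_set[OF B ind, of "1 / Suc i" "\<lambda>b. t b - of_int s * (b / of_int N)"]) (simp, blast)
    then obtain k :: "nat \<Rightarrow> int" and m :: "nat \<Rightarrow> real \<Rightarrow> int" where
      km: "\<And>i b. b \<in> B - {1} \<Longrightarrow> \<bar>of_int (k i) * b - of_int (m i b) - (t b - of_int s * (b / of_int N))\<bar> < 1 / Suc i"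
      by metis
    let ?l = "\<lambda>i. s + N * k i"
    let ?t = "\<lambda>i b. of_int (?l i) * (b / of_int N) - of_int (m i b)"
    have lim: "(\<lambda>i. ?t i b) \<longlonglongrightarrow> t b" if "b \<in> B - {1}" for b
    proof -
      have "(\<lambda>i. ?t i b - t b) \<longlonglongrightarrow> 0"
      proof (rule Lim_null_comparison)
        show "(\<lambda>i. 1 / real (Suc i)) \<longlonglongrightarrow> 0" by (rule LIMSEQ_Suc[OF lim_1_over_n])
        have "?t i b - t b = of_int (k i) * b - of_int (m i b) - (t b - of_int s * (b / of_int N))" for i
          using N by (simp add: field_simps)
        then have "norm (?t i b - t b) \<le> 1 / real (Suc i)" for i
          unfolding real_norm_def using km[OF that, of i] by (simp only: less_imp_le)
        then show "\<forall>\<^sub>F i in sequentially. norm (?t i b - t b) \<le> 1 / real (Suc i)"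
          by (intro always_eventually allI)
      qed
      then show ?thesis by (simp add: LIM_zero_iff)
    qed
    have eq: "?f s (?t i) = Psi \<Theta> (?l i)" for i
      unfolding Psi
    proof (rule torus_pt_cong_Ints)
      fix j
      let ?X = "\<Sum>b\<in>B - {1}. of_int (n j b) * (of_int (?l i) * (b / of_int N))"
      have "(\<Sum>b\<in>B - {1}. of_int (n j b) * ?t i b) = ?X - of_int (\<Sum>b\<in>B - {1}. n j b * m i b)"
        by (simp only: right_diff_distrib sum_subtractf of_int_sum of_int_mult)
      moreover have "real_of_int (?l i) / of_int N = of_int s / of_int N + of_int (k i)"
        using N by (simp add: add_divide_distrib)
      ultimately have "of_int (n j 1) * (of_int s / of_int N) + (\<Sum>b\<in>B - {1}. of_int (n j b) * ?t i b) -
         (of_int (n j 1) * (of_int (?l i) / of_int N) + (\<Sum>b\<in>B - {1}. of_int (n j b) * (of_int (?l i) * (b / of_int N))))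
        = of_int (- n j 1 * k i - (\<Sum>b\<in>B - {1}. n j b * m i b))"
        by (simp only: of_int_diff of_int_mult of_int_minus distrib_left)
      then show "of_int (n j 1) * (of_int s / of_int N) + (\<Sum>b\<in>B - {1}. of_int (n j b) * ?t i b) -
         (of_int (n j 1) * (of_int (?l i) / of_int N) + (\<Sum>b\<in>B - {1}. of_int (n j b) * (of_int (?l i) * (b / of_int N)))) \<in> \<int>"
        by (metis Ints_of_int)
    qed
    have "(\<lambda>i. ?f s (?t i)) \<longlonglongrightarrow> ?f s t"
      by (intro tendsto_torus_pt tendsto_intros tendsto_sum lim)
    then have lim: "(\<lambda>i. Psi \<Theta> (?l i)) \<longlonglongrightarrow> ?f s t" unfolding eq .
    have "Psi \<Theta> (?l i) \<in> closure (range (Psi \<Theta>))" for i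
      by (rule subsetD[OF closure_subset rangeI])
    then show ?thesis
      unfolding G_def by (rule closed_sequentially[OF closed_closure _ lim])
  qed
  ultimately show ?thesis unfolding S(2) by auto
qed

theorem admits_haar_G: "admits_haar (G \<Theta>)"
proof -
  obtain B N n where B: "finite B" "1 \<in> B" and N: "N > (0::int)"
    and ind: "module.independent (\<lambda>(r::int) x. of_int r * (x::real)) B"
    and n: "\<And>x. x \<in> range (\<lambda>j. \<Theta> $ j / (2 * pi)) \<Longrightarrow> of_int N * x = (\<Sum>b\<in>B. of_int (n x b) * b)"
    by (rule finite_reals_rational_basis[of "range (\<lambda>j. \<Theta> $ j / (2 * pi))"]) auto
  define n' where "n' = (\<lambda>j b. n (\<Theta> $ j / (2 * pi)) b)"
  define S where "S = range (\<lambda>(s::int, t). torus_pt (\<lambda>j. of_int (n' j 1) * (of_int s / of_int N)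
    + (\<Sum>b\<in>B - {1}. of_int (n' j b) * t b)))"
  have S: "admits_haar S"
    unfolding S_def using B N by (intro admits_haar_torus_times_cyclic) auto
  have "G \<Theta> = S"
  proof (rule G_eq_torus_times_cyclic[OF B N ind _ _ S_def])
    show "of_int N * (\<Theta> $ j / (2 * pi)) = (\<Sum>b\<in>B. of_int (n' j b) * b)" for j
      unfolding n'_def by (rule n) simp
    show "compact S" using S by (simp add: admits_haar_def)
  qed
  then show ?thesis using S by simp
qed

section \<open>Haar measure on the orbit closure\<close>

lemma norm_Psi_nth [simp]: "norm (Psi \<Theta> k $ j) = 1"
  by (simp add: Psi_def)

lemma norm_G_nth:
  assumes "z \<in> G \<Theta>" shows "norm (z $ j) = 1"
proof -
  have "closure (range (Psi \<Theta>)) \<subseteq> {z. norm (z $ j) = 1}"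
    by (intro closure_minimal closed_Collect_eq continuous_intros) auto
  then show ?thesis using assms by (auto simp: G_def)
qed

lemma norm_mult_unimodular:
  fixes g z :: "complex ^ 'm"
  assumes "\<And>j. norm (g $ j) = 1"
  shows "norm (g * z) = norm z"
  using assms by (simp add: norm_vec_def norm_mult)

lemma Psi_add: "Psi \<Theta> (k + l) = Psi \<Theta> k * Psi \<Theta> l"
  by (simp add: Psi_def vec_eq_iff distrib_left distrib_right exp_add)

lemma Psi_in_G: "Psi \<Theta> k \<in> G \<Theta>"
  unfolding G_def by (rule subsetD[OF closure_subset rangeI])

lemma compact_G: "compact (G \<Theta>)"
  and G_mult: "x \<in> G \<Theta> \<Longrightarrow> y \<in> G \<Theta> \<Longrightarrow> x * y \<in> G \<Theta>"
  using admits_haar_G[of \<Theta>] by (auto simp: admits_haar_def)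

abbreviation haar :: "real ^ 'm \<Rightarrow> (complex ^ 'm) measure" where
  "haar \<Theta> \<equiv> haar_prob (G \<Theta>)"

lemma is_haar_prob_haar: "is_haar_prob (G \<Theta>) (haar \<Theta>)"
  unfolding haar_prob_def by (rule someI_ex) (use admits_haar_G[of \<Theta>] in \<open>simp add: admits_haar_def\<close>)

lemma prob_space_haar: "prob_space (haar \<Theta>)"
  and sets_haar: "sets (haar \<Theta>) = sets (restrict_space borel (G \<Theta>))"
  using is_haar_prob_haar[of \<Theta>] by (auto simp: is_haar_prob_def)

lemma space_haar: "space (haar \<Theta>) = G \<Theta>"
  using sets_eq_imp_space_eq[OF sets_haar] by (simp add: space_restrict_space)

lemma borel_measurable_haar:
  assumes "continuous_on (G \<Theta>) h" shows "h \<in> borel_measurable (haar \<Theta>)"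
  using borel_measurable_continuous_on_restrict[OF assms] measurable_cong_sets[OF sets_haar refl] by auto

lemma integrable_haar:
  fixes h :: "complex ^ 'm \<Rightarrow> 'b::{banach, second_countable_topology}"
  assumes "h \<in> borel_measurable (haar \<Theta>)" "\<And>z. z \<in> G \<Theta> \<Longrightarrow> norm (h z) \<le> B"
  shows "integrable (haar \<Theta>) h"
proof -
  interpret prob_space "haar \<Theta>" by (rule prob_space_haar)
  show ?thesis by (rule integrable_const_bound[of _ B]) (use assms in \<open>auto simp: space_haar\<close>)
qed

lemma measurable_haar_translation:
  assumes "g \<in> G \<Theta>" shows "(\<lambda>z. g * z) \<in> haar \<Theta> \<rightarrow>\<^sub>M haar \<Theta>"
  by (intro measurable_translation[OF sets_haar] assms ballI G_mult)

lemma integral_haar_translation: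
  fixes h :: "complex ^ 'm \<Rightarrow> 'b::{banach, second_countable_topology}"
  assumes "g \<in> G \<Theta>" "h \<in> borel_measurable (haar \<Theta>)"
  shows "(LINT z|haar \<Theta>. h (g * z)) = (LINT z|haar \<Theta>. h z)"
proof -
  have "distr (haar \<Theta>) (haar \<Theta>) (\<lambda>z. g * z) = haar \<Theta>"
    using is_haar_prob_haar assms by (auto simp: is_haar_prob_def)
  then show ?thesis
    using integral_distr[OF measurable_haar_translation[OF assms(1)] assms(2)] by simp
qed

section \<open>Abel means and equidistribution\<close>

text \<open>The Abel mean at radius \<open>r\<close> is the expectation of \<open>u\<close> at a geometrically distributed time; for
  \<open>r \<rightarrow> 1\<close> it becomes insensitive to shifts of \<open>u\<close>.\<close>

definition abel_mean :: "(nat \<Rightarrow> 'a::banach) \<Rightarrow> real \<Rightarrow> 'a" where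
  "abel_mean u r = (1 - r) *\<^sub>R (\<Sum>n. r ^ n *\<^sub>R u n)"

lemma summable_abel:
  fixes u :: "nat \<Rightarrow> 'a::banach"
  assumes "\<And>n. norm (u n) \<le> B" "0 \<le> r" "r < 1"
  shows "summable (\<lambda>n. norm (r ^ n *\<^sub>R u n))"
proof (rule summable_comparison_test')
  show "summable (\<lambda>n. r ^ n * B)" using assms by (intro summable_mult2 summable_geometric) auto
  show "norm (norm (r ^ n *\<^sub>R u n)) \<le> r ^ n * B" for n
    using assms by (simp add: mult_left_mono)
qed

lemmas summable_abel' = summable_norm_cancel[OF summable_abel]

lemma abel_mean_const: "0 \<le> r \<Longrightarrow> r < 1 \<Longrightarrow> abel_mean (\<lambda>_. c) r = c"
  using suminf_scaleR_left[of "\<lambda>n. r ^ n" c, symmetric] by (simp add: abel_mean_def suminf_geometric summable_geometric)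

lemma abel_mean_add:
  fixes u v :: "nat \<Rightarrow> 'a::banach"
  assumes "\<And>n. norm (u n) \<le> B" "\<And>n. norm (v n) \<le> C" "0 \<le> r" "r < 1"
  shows "abel_mean (\<lambda>n. u n + v n) r = abel_mean u r + abel_mean v r"
  using suminf_add[OF summable_abel'[of u B r] summable_abel'[of v C r], symmetric] assms
  by (simp add: abel_mean_def scaleR_add_right)

lemma abel_mean_diff:
  fixes u v :: "nat \<Rightarrow> 'a::banach"
  assumes "\<And>n. norm (u n) \<le> B" "\<And>n. norm (v n) \<le> C" "0 \<le> r" "r < 1"
  shows "abel_mean (\<lambda>n. u n - v n) r = abel_mean u r - abel_mean v r"
  using suminf_diff[OF summable_abel'[of u B r] summable_abel'[of v C r], symmetric] assms
  by (simp add: abel_mean_def scaleR_diff_right)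

lemma abel_mean_bounded_linear:
  fixes u :: "nat \<Rightarrow> 'a::banach"
  assumes "bounded_linear L" "\<And>n. norm (u n) \<le> B" "0 \<le> r" "r < 1"
  shows "abel_mean (\<lambda>n. L (u n)) r = L (abel_mean u r)"
  using bounded_linear.suminf[OF assms(1) summable_abel'[of u B r]] assms
  by (simp add: abel_mean_def linear_simps(5))

lemma norm_abel_mean_le:
  fixes u :: "nat \<Rightarrow> 'a::banach"
  assumes "\<And>n. norm (u n) \<le> v n" "\<And>n. v n \<le> B" "0 \<le> r" "r < 1"
  shows "norm (abel_mean u r) \<le> abel_mean v r"
proof -
  have v: "norm (v n) \<le> B" for n
    using assms(2)[of n] order_trans[OF norm_ge_zero assms(1)[of n]] by simp
  have u: "norm (u n) \<le> B" for n using assms(1,2)[of n] by linarith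
  have "norm (\<Sum>n. r ^ n *\<^sub>R u n) \<le> (\<Sum>n. norm (r ^ n *\<^sub>R u n))"
    by (rule summable_norm) (rule summable_abel[OF u assms(3,4)])
  also have "\<dots> \<le> (\<Sum>n. r ^ n *\<^sub>R v n)"
    by (intro suminf_le summable_abel[OF u assms(3,4)] summable_abel'[OF v assms(3,4)])
       (use assms in \<open>simp add: mult_left_mono\<close>)
  finally show ?thesis
    using assms(4) by (simp add: abel_mean_def mult_left_mono)
qed

lemma norm_abel_mean_shift_le:
  fixes u :: "nat \<Rightarrow> 'a::banach"
  assumes u: "\<And>n. norm (u n) \<le> B" and r: "0 \<le> r" "r < 1"
  shows "norm (abel_mean (\<lambda>n. u (Suc n)) r - abel_mean u r) \<le> (1 - r) * (2 * B)"
proof -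
  let ?s = "abel_mean (\<lambda>n. u (Suc n)) r"
  have "(\<Sum>n. r ^ n *\<^sub>R u n) = u 0 + (\<Sum>n. r ^ Suc n *\<^sub>R u (Suc n))"
    using suminf_split_head[OF summable_abel'[of u, OF u r]] by simp
  also have "(\<Sum>n. r ^ Suc n *\<^sub>R u (Suc n)) = r *\<^sub>R (\<Sum>n. r ^ n *\<^sub>R u (Suc n))"
    using suminf_scaleR_right[OF summable_abel'[of "\<lambda>n. u (Suc n)", OF u r], of r] by simp
  finally have "?s - abel_mean u r = (1 - r) *\<^sub>R (?s - u 0)"
    by (simp add: abel_mean_def algebra_simps)
  moreover have "norm (?s - u 0) \<le> 2 * B"
  proof -
    have "norm ?s \<le> B"
      using norm_abel_mean_le[of "\<lambda>n. u (Suc n)" "\<lambda>_. B" B r] u r by (simp add: abel_mean_const)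
    then show ?thesis using norm_triangle_ineq4[of ?s "u 0"] u[of 0] by linarith
  qed
  ultimately show ?thesis using r by (simp add: mult_left_mono)
qed

text \<open>A single shift changes the mean by \<open>O(1 - r)\<close>; induction reaches any integer shift.\<close>

lemma abel_mean_int_shift:
  fixes u :: "int \<Rightarrow> 'a::banach"
  assumes u: "\<And>n. norm (u n) \<le> B" and r: "\<And>i. 0 \<le> r i" "\<And>i. r i < 1" "r \<longlonglongrightarrow> 1"
  shows "(\<lambda>i. abel_mean (\<lambda>n. u (int n + l)) (r i) - abel_mean (\<lambda>n. u (int n)) (r i)) \<longlonglongrightarrow> 0"
    (is "(\<lambda>i. ?A l i - ?base i) \<longlonglongrightarrow> 0")
proof -
  have lim: "(\<lambda>i. (1 - r i) * (2 * B)) \<longlonglongrightarrow> 0"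
    by (rule tendsto_eq_intros r refl)+ simp
  have step: "(\<lambda>i. ?A (l + 1) i - ?A l i) \<longlonglongrightarrow> 0" for l
  proof (rule Lim_null_comparison[OF always_eventually lim], rule allI)
    show "norm (?A (l + 1) i - ?A l i) \<le> (1 - r i) * (2 * B)" for i
      using norm_abel_mean_shift_le[of "\<lambda>n. u (int n + l)" B "r i"] u r(1,2) by (simp add: add_ac)
  qed
  show ?thesis
  proof (induction l rule: int_induct[where k = 0])
    case (step1 l)
    then show ?case using tendsto_add[OF step1.IH step[of l]] by simp
  next
    case (step2 l)
    then show ?case using tendsto_diff[OF step2.IH step[of "l - 1"]] by simp
  qed simp
qed

text \<open>Equidistribution of the orbit. Let \<open>m z i\<close> be the Abel mean of \<open>h\<close> along the orbit of \<open>z\<close>. By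
  invariance of the measure its integral over \<open>z\<close> is the integral of \<open>h\<close>, for every \<open>i\<close>. On the other
  hand \<open>m z i\<close> is asymptotically independent of \<open>z\<close>: for \<open>z\<close> on the orbit of \<open>1\<close> this is shift
  invariance, and in general the orbit of \<open>z\<close> stays uniformly close to that of a nearby point
  \<open>\<Psi>(l)\<close>, because translations are isometries, and \<open>h\<close> is uniformly continuous. Dominated convergence then compares
  the integral with \<open>m 1 i\<close>.\<close>

theorem abel_mean_tendsto_haar_integral:
  fixes h :: "complex ^ 'm \<Rightarrow> real"
  assumes h: "continuous_on (G \<Theta>) h" and r: "\<And>i. 0 \<le> r i" "\<And>i. r i < 1" "r \<longlonglongrightarrow> 1"
  shows "(\<lambda>i. abel_mean (\<lambda>n. h (Psi \<Theta> (int n))) (r i)) \<longlonglongrightarrow> (LINT z|haar \<Theta>. h z)"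
proof -
  interpret prob_space "haar \<Theta>" by (rule prob_space_haar)
  define m where "m = (\<lambda>z i. abel_mean (\<lambda>n. h (Psi \<Theta> (int n) * z)) (r i))"
  have m1: "m 1 i = abel_mean (\<lambda>n. h (Psi \<Theta> (int n))) (r i)" for i by (simp add: m_def)
  have one: "1 \<in> G \<Theta>" using Psi_in_G[of \<Theta> 0] by (simp add: Psi_def one_vec_def)
  obtain B where "\<And>x. x \<in> h ` G \<Theta> \<Longrightarrow> norm x \<le> B"
    using compact_imp_bounded[OF compact_continuous_image[OF h compact_G]] by (auto simp: bounded_iff)
  then have B: "\<bar>h z\<bar> \<le> B" if "z \<in> G \<Theta>" for z using that by simp
  note orbit = G_mult[OF Psi_in_G]
  have hm: "h \<in> borel_measurable (haar \<Theta>)" by (rule borel_measurable_haar[OF h])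
  have hPm: "(\<lambda>z. h (Psi \<Theta> k * z)) \<in> borel_measurable (haar \<Theta>)" for k
    by (rule measurable_compose[OF measurable_haar_translation[OF Psi_in_G] hm])
  have integral_m: "(LINT z|haar \<Theta>. m z i) = (LINT z|haar \<Theta>. h z)" for i
  proof -
    have bd: "norm (r i ^ n *\<^sub>R h (Psi \<Theta> (int n) * z)) \<le> r i ^ n * B" if "z \<in> G \<Theta>" for n z
      using B[OF orbit[OF that], of "int n"] r(1)[of i] by (simp add: mult_left_mono abs_mult)
    have sB: "summable (\<lambda>n. r i ^ n * B)" using r by (intro summable_mult2 summable_geometric) auto
    have int: "integrable (haar \<Theta>) (\<lambda>z. r i ^ n *\<^sub>R h (Psi \<Theta> (int n) * z))" for n
      using bd by (intro integrable_haar[of _ _ "r i ^ n * B"] borel_measurable_scaleR hPm) auto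
    have "(LINT z|haar \<Theta>. (\<Sum>n. r i ^ n *\<^sub>R h (Psi \<Theta> (int n) * z)))
        = (\<Sum>n. LINT z|haar \<Theta>. r i ^ n *\<^sub>R h (Psi \<Theta> (int n) * z))"
    proof (rule integral_suminf[OF int])
      show "AE z in haar \<Theta>. summable (\<lambda>n. norm (r i ^ n *\<^sub>R h (Psi \<Theta> (int n) * z)))"
        by (intro AE_I2 summable_abel[of _ B] r) (use B orbit in \<open>auto simp: space_haar\<close>)
      show "summable (\<lambda>n. LINT z|haar \<Theta>. norm (r i ^ n *\<^sub>R h (Psi \<Theta> (int n) * z)))"
      proof (rule summable_comparison_test'[OF sB])
        fix n
        have "(LINT z|haar \<Theta>. norm (r i ^ n *\<^sub>R h (Psi \<Theta> (int n) * z))) \<le> (LINT z|haar \<Theta>. r i ^ n * B)"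
          by (intro integral_mono integrable_norm int) (use bd in \<open>auto simp: space_haar\<close>)
        then show "norm (LINT z|haar \<Theta>. norm (r i ^ n *\<^sub>R h (Psi \<Theta> (int n) * z))) \<le> r i ^ n * B"
          by (simp add: prob_space)
      qed
    qed
    also have "\<dots> = (\<Sum>n. r i ^ n *\<^sub>R (LINT z|haar \<Theta>. h z))"
      by (simp add: integral_haar_translation[OF Psi_in_G hm])
    finally have "(LINT z|haar \<Theta>. m z i) = abel_mean (\<lambda>_. LINT z|haar \<Theta>. h z) (r i)"
      by (simp add: m_def abel_mean_def)
    then show ?thesis using r by (simp add: abel_mean_const)
  qed
  have m_bd: "\<bar>m z i\<bar> \<le> B" if "z \<in> G \<Theta>" for z i
    using norm_abel_mean_le[of "\<lambda>n. h (Psi \<Theta> (int n) * z)" "\<lambda>_. B" B "r i"] B orbit[OF that] r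
    by (simp add: m_def abel_mean_const)
  have m_meas: "(\<lambda>z. m z i) \<in> borel_measurable (haar \<Theta>)" for i
    unfolding m_def abel_mean_def
    by (intro borel_measurable_scaleR borel_measurable_suminf hPm) auto
  have m_int: "integrable (haar \<Theta>) (\<lambda>z. m z i)" for i
    using m_bd by (intro integrable_haar[OF m_meas, of _ B]) auto
  have diff: "(\<lambda>i. m z i - m 1 i) \<longlonglongrightarrow> 0" if z: "z \<in> G \<Theta>" for z
  proof (rule LIMSEQ_I)
    fix e :: real assume e: "e > 0"
    have "uniformly_continuous_on (G \<Theta>) h"
      by (rule compact_uniformly_continuous[OF h compact_G])
    then obtain d where d: "d > 0" "\<And>x y. x \<in> G \<Theta> \<Longrightarrow> y \<in> G \<Theta> \<Longrightarrow> dist x y < d \<Longrightarrow> dist (h x) (h y) < e / 2"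
      using e by (metis half_gt_zero uniformly_continuous_on_def)
    obtain l where l: "dist (Psi \<Theta> l) z < d"
      using z d(1) by (auto simp: G_def closure_approachable)
    have close: "\<bar>m z i - m (Psi \<Theta> l) i\<bar> \<le> e / 2" for i
    proof -
      have *: "\<bar>h (Psi \<Theta> (int n) * z) - h (Psi \<Theta> (int n) * Psi \<Theta> l)\<bar> \<le> e / 2" for n
      proof -
        have "dist (Psi \<Theta> (int n) * z) (Psi \<Theta> (int n) * Psi \<Theta> l) = norm (Psi \<Theta> (int n) * (z - Psi \<Theta> l))"
          by (simp add: dist_norm vec_eq_iff algebra_simps norm_vec_def)
        also have "\<dots> = dist (Psi \<Theta> l) z"
          by (simp add: norm_mult_unimodular dist_norm norm_minus_commute)
        finally show ?thesis
          using d(2)[OF orbit[OF z] orbit[OF Psi_in_G], of "int n" "int n" l] l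
          by (simp add: dist_real_def)
      qed
      have "m z i - m (Psi \<Theta> l) i = abel_mean (\<lambda>n. h (Psi \<Theta> (int n) * z) - h (Psi \<Theta> (int n) * Psi \<Theta> l)) (r i)"
        unfolding m_def by (rule abel_mean_diff[of _ B _ B, symmetric]) (simp_all add: B orbit z Psi_in_G r)
      also have "\<bar>\<dots>\<bar> \<le> abel_mean (\<lambda>_. e / 2) (r i)"
        using norm_abel_mean_le[of "\<lambda>n. h (Psi \<Theta> (int n) * z) - h (Psi \<Theta> (int n) * Psi \<Theta> l)" "\<lambda>_. e / 2" "e / 2" "r i"] * r
        by simp
      finally show ?thesis using r by (simp add: abel_mean_const)
    qed
    have "(\<lambda>i. m (Psi \<Theta> l) i - m 1 i) \<longlonglongrightarrow> 0"
    proof -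
      have "norm (h (Psi \<Theta> k)) \<le> B" for k using B[OF Psi_in_G] by simp
      from abel_mean_int_shift[of "\<lambda>k. h (Psi \<Theta> k)", OF this r, of l]
      show ?thesis by (simp add: m_def Psi_add)
    qed
    then obtain N where N: "\<And>i. i \<ge> N \<Longrightarrow> \<bar>m (Psi \<Theta> l) i - m 1 i\<bar> < e / 2"
      using LIMSEQ_D[of _ 0 "e / 2"] e by fastforce
    show "\<exists>N. \<forall>i\<ge>N. norm (m z i - m 1 i - 0) < e"
    proof (intro exI allI impI)
      fix i assume "i \<ge> N"
      then show "norm (m z i - m 1 i - 0) < e" using N[of i] close[of i] unfolding real_norm_def by arith
    qed
  qed
  have "(\<lambda>i. LINT z|haar \<Theta>. m z i - m 1 i) \<longlonglongrightarrow> (LINT z|haar \<Theta>. 0)"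
  proof (rule integral_dominated_convergence[where w = "\<lambda>_. 2 * B"])
    show "AE z in haar \<Theta>. (\<lambda>i. m z i - m 1 i) \<longlonglongrightarrow> 0"
      using diff by (intro AE_I2) (simp add: space_haar)
    show "AE z in haar \<Theta>. norm (m z i - m 1 i) \<le> 2 * B" for i
    proof (rule AE_I2)
      fix z assume "z \<in> space (haar \<Theta>)"
      then show "norm (m z i - m 1 i) \<le> 2 * B"
        using m_bd[of z i] m_bd[OF one, of i] by (simp add: space_haar)
    qed
  qed (use m_meas in auto)
  then have "(\<lambda>i. (LINT z|haar \<Theta>. h z) - m 1 i) \<longlonglongrightarrow> 0"
    using m_int by (simp add: integral_m prob_space)
  then have "(\<lambda>i. m 1 i) \<longlonglongrightarrow> (LINT z|haar \<Theta>. h z)"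
    using tendsto_diff[OF tendsto_const, of _ 0 sequentially "LINT z|haar \<Theta>. h z"] by fastforce
  then show ?thesis by (simp add: m1)
qed

text \<open>Translating by \<open>\<Psi>(1)\<close> multiplies the integral by \<open>exp (i (\<theta>\<^sub>j - \<theta>\<^sub>i))\<close>, which differs from \<open>1\<close>
  because the phases are distinct modulo \<open>2\<pi>\<close>.\<close>

lemma haar_orthonormal:
  fixes \<Theta> :: "real ^ 'm"
  assumes distinct: "\<And>i j. i \<noteq> j \<Longrightarrow> \<not> [\<Theta> $ i = \<Theta> $ j] (rmod (2 * pi))"
  shows "(LINT z|haar \<Theta>. z $ j * cnj (z $ i)) = (if i = j then 1 else 0)"
proof (cases "i = j")
  case True
  interpret prob_space "haar \<Theta>" by (rule prob_space_haar)
  have "(LINT z|haar \<Theta>. z $ j * cnj (z $ i)) = (LINT z|haar \<Theta>. 1)"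
    by (intro Bochner_Integration.integral_cong refl) (auto simp: True space_haar complex_norm_square[symmetric] norm_G_nth)
  then show ?thesis using True by (simp add: prob_space)
next
  case False
  let ?I = "LINT z|haar \<Theta>. z $ j * cnj (z $ i)" and ?g = "Psi \<Theta> 1"
  have "?I = (LINT z|haar \<Theta>. (?g * z) $ j * cnj ((?g * z) $ i))"
    by (rule integral_haar_translation[OF Psi_in_G, symmetric])
       (intro borel_measurable_haar continuous_intros)
  also have "\<dots> = (LINT z|haar \<Theta>. (?g $ j * cnj (?g $ i)) * (z $ j * cnj (z $ i)))"
    by (simp add: mult_ac)
  also have "\<dots> = (?g $ j * cnj (?g $ i)) * ?I"
    by simp
  also have "?g $ j * cnj (?g $ i) = cis (\<Theta> $ j - \<Theta> $ i)"
    by (simp add: Psi_def cis_cnj cis_mult flip: cis_conv_exp)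
  finally have "?I = cis (\<Theta> $ j - \<Theta> $ i) * ?I" .
  moreover have "cis (\<Theta> $ j - \<Theta> $ i) \<noteq> 1"
  proof
    assume "cis (\<Theta> $ j - \<Theta> $ i) = 1"
    then have "exp (\<i> * of_real (\<Theta> $ j - \<Theta> $ i)) = 1" by (simp add: cis_conv_exp)
    then obtain n :: int where "\<Theta> $ j - \<Theta> $ i = of_int (2 * n) * pi"
      by (auto simp: exp_eq_1)
    then have "\<Theta> $ j = \<Theta> $ i + of_int n * (2 * pi)" by simp
    then have "[\<Theta> $ j = \<Theta> $ i] (rmod (2 * pi))"
      using rcong_add_left_cancel[of "\<Theta> $ i" "of_int n * (2 * pi)" 0] rcong_mult_of_int_0_left_right[of n "2 * pi"]
      by simp
    then show False using distinct[of j i] False by auto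
  qed
  ultimately show ?thesis using False by simp
qed

section \<open>Trigonometric sums and duality\<close>

lemma inner_mult_cnj: "inner c (w * cnj z) = inner (c * z) (w::complex)"
  by (simp add: inner_complex_def algebra_simps)

definition char_sum :: "complex ^ 'm \<Rightarrow> complex ^ 'm \<Rightarrow> complex" where
  "char_sum c z = (\<Sum>j\<in>UNIV. c $ j * z $ j)"

lemma continuous_on_char_sum: "continuous_on A (char_sum c)"
  unfolding char_sum_def by (intro continuous_intros)

lemma norm_char_sum_le: "z \<in> G \<Theta> \<Longrightarrow> norm (char_sum c z) \<le> (\<Sum>j\<in>UNIV. norm (c $ j))"
  unfolding char_sum_def by (rule order_trans[OF norm_sum]) (simp add: norm_mult norm_G_nth)

text \<open>Real-linear functionals of the coefficient vectors \<open>(w z\<^sub>j\<^sup>*)\<^sub>j\<close> are pairings of \<open>w\<close> with a trigonometric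
  sum; this turns the dual problem in \<open>\<complex>\<^sup>m\<close> into one about \<open>L\<^sup>1\<close> norms on the group.\<close>

lemma inner_char_sum:
  "inner c (\<chi> j. w * cnj (z $ j)) = inner (char_sum c z) w"
  by (simp add: inner_vec_def char_sum_def inner_mult_cnj inner_sum_left)

lemma integrable_mult_cnj_nth:
  fixes f :: "complex ^ 'm \<Rightarrow> complex"
  assumes "f \<in> borel_measurable (haar \<Theta>)" "\<And>z. z \<in> G \<Theta> \<Longrightarrow> norm (f z) \<le> B"
  shows "integrable (haar \<Theta>) (\<lambda>z. f z * cnj (z $ j))"
proof (rule integrable_haar[of _ _ B])
  show "(\<lambda>z. f z * cnj (z $ j)) \<in> borel_measurable (haar \<Theta>)"
    by (rule borel_measurable_times[OF assms(1) borel_measurable_haar]) (intro continuous_intros)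
qed (use assms in \<open>simp add: norm_mult norm_G_nth\<close>)

text \<open>Each Fourier coefficient \<open>c\<^sub>i\<close> of the sum is bounded by its \<open>L\<^sup>1\<close> norm.\<close>

lemma L1_norm_char_sum_pos:
  fixes \<Theta> :: "real ^ 'm"
  assumes distinct: "\<And>i j. i \<noteq> j \<Longrightarrow> \<not> [\<Theta> $ i = \<Theta> $ j] (rmod (2 * pi))"
    and "c \<noteq> 0"
  shows "0 < (LINT z|haar \<Theta>. norm (char_sum c z))"
proof -
  interpret prob_space "haar \<Theta>" by (rule prob_space_haar)
  obtain i where i: "c $ i \<noteq> 0" using assms(2) by (auto simp: vec_eq_iff)
  have int: "integrable (haar \<Theta>) (\<lambda>z. z $ j * cnj (z $ i))" for j
    by (rule integrable_mult_cnj_nth[of _ _ 1]) (auto simp: norm_G_nth intro!: borel_measurable_haar continuous_intros)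
  have "(LINT z|haar \<Theta>. char_sum c z * cnj (z $ i)) = (LINT z|haar \<Theta>. (\<Sum>j\<in>UNIV. c $ j * (z $ j * cnj (z $ i))))"
    by (simp add: char_sum_def sum_distrib_right mult.assoc)
  also have "\<dots> = (\<Sum>j\<in>UNIV. c $ j * (LINT z|haar \<Theta>. z $ j * cnj (z $ i)))"
    using int by (subst Bochner_Integration.integral_sum) auto
  also have "\<dots> = c $ i"
    by (simp add: haar_orthonormal[OF distinct] if_distrib cong: if_cong)
  finally have "norm (c $ i) = norm (LINT z|haar \<Theta>. char_sum c z * cnj (z $ i))" by simp
  also have "\<dots> \<le> (LINT z|haar \<Theta>. norm (char_sum c z * cnj (z $ i)))"
    by (rule integral_norm_bound)
  also have "\<dots> = (LINT z|haar \<Theta>. norm (char_sum c z))"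
    by (intro Bochner_Integration.integral_cong refl) (simp add: norm_mult space_haar norm_G_nth)
  finally have "norm (c $ i) \<le> (LINT z|haar \<Theta>. norm (char_sum c z))" .
  moreover have "0 < norm (c $ i)" using i by simp
  ultimately show ?thesis by linarith
qed

text \<open>The duality between \<open>L\<^sup>1\<close> and \<open>L\<^sup>\<infinity>\<close>, in the finite-dimensional form that is needed. The coefficient
  vectors of functions bounded by \<open>B\<close> form a convex set in \<open>\<complex>\<^sup>m\<close>. If \<open>a\<close> were outside, a hyperplane
  with normal \<open>c\<close> would separate it; testing against \<open>f = B sgn(\<Sum> c\<^sub>j z\<^sub>j)\<close>, the function for which
  the pairing with \<open>c\<close> is largest, would give \<open>c \<bullet> a \<ge> B \<parallel>\<Sum> c\<^sub>j z\<^sub>j\<parallel>\<^sub>1\<close>.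
  Since separation of a point from an arbitrary convex set is only weak, the hypothesis is strict.\<close>

theorem q_le_if_dual_bound:
  fixes \<Theta> :: "real ^ 'm"
  assumes "B \<ge> 0" and dual: "\<And>c. c \<noteq> 0 \<Longrightarrow> inner c a < B * (LINT z|haar \<Theta>. norm (char_sum c z))"
  shows "q \<Theta> a \<le> ereal B"
proof -
  interpret prob_space "haar \<Theta>" by (rule prob_space_haar)
  define coeff where "coeff = (\<lambda>f::complex ^ 'm \<Rightarrow> complex. (\<chi> j. LINT z|haar \<Theta>. f z * cnj (z $ j)) :: complex ^ 'm)"
  define D where "D = {f :: complex ^ 'm \<Rightarrow> complex. f \<in> borel_measurable (haar \<Theta>) \<and> (\<forall>z\<in>G \<Theta>. norm (f z) \<le> B)}"
  have int: "integrable (haar \<Theta>) (\<lambda>z. f z * cnj (z $ j))" if "f \<in> D" for f j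
    using that by (intro integrable_mult_cnj_nth[of _ _ B]) (auto simp: D_def)
  have "a \<in> coeff ` D"
  proof (rule ccontr)
    assume a: "a \<notin> coeff ` D"
    have "convex (coeff ` D)"
    proof (rule convexI)
      fix x y :: "complex ^ 'm" and u v :: real
      assume "x \<in> coeff ` D" "y \<in> coeff ` D" and uv: "0 \<le> u" "0 \<le> v" "u + v = 1"
      then obtain f g where f: "f \<in> D" "x = coeff f" and g: "g \<in> D" "y = coeff g" by auto
      let ?h = "\<lambda>z. u *\<^sub>R f z + v *\<^sub>R g z"
      have "norm (?h z) \<le> B" if z: "z \<in> G \<Theta>" for z
      proof -
        have "norm (?h z) \<le> u * norm (f z) + v * norm (g z)"
          using uv by (intro order_trans[OF norm_triangle_ineq]) simp
        also have "\<dots> \<le> u * B + v * B"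
          using f g z uv by (intro add_mono mult_left_mono) (auto simp: D_def)
        finally show ?thesis using uv by (simp flip: distrib_right)
      qed
      then have h: "?h \<in> D" using f g by (auto simp: D_def)
      have eq: "coeff ?h = u *\<^sub>R x + v *\<^sub>R y"
        using int[OF f(1)] int[OF g(1)] by (simp add: f g coeff_def vec_eq_iff distrib_right)
      show "u *\<^sub>R x + v *\<^sub>R y \<in> coeff ` D"
        unfolding eq[symmetric] using h by (rule imageI)
    qed
    moreover have "(\<lambda>_. 0) \<in> D" using assms(1) by (simp add: D_def)
    ultimately obtain c b where c: "c \<noteq> 0" "\<And>x. x \<in> coeff ` D \<Longrightarrow> inner c x \<le> b" "b \<le> inner c a"
      using separating_hyperplane_sets[of "coeff ` D" "{a}"] a by blast
    define f where "f = (\<lambda>z. B *\<^sub>R sgn (char_sum c z))"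
    have "char_sum c \<in> borel_measurable (haar \<Theta>)"
      by (rule borel_measurable_haar[OF continuous_on_char_sum])
    then have "f \<in> D"
      using assms(1) by (auto simp: D_def f_def norm_sgn)
    have "inner c (coeff f) = (\<Sum>j\<in>UNIV. inner (c $ j) (LINT z|haar \<Theta>. f z * cnj (z $ j)))"
      by (simp add: inner_vec_def coeff_def)
    also have "\<dots> = (LINT z|haar \<Theta>. (\<Sum>j\<in>UNIV. inner (c $ j) (f z * cnj (z $ j))))"
      using int[OF \<open>f \<in> D\<close>] by (subst Bochner_Integration.integral_sum) (auto simp: integral_inner_right)
    also have "(\<lambda>z. \<Sum>j\<in>UNIV. inner (c $ j) (f z * cnj (z $ j))) = (\<lambda>z. inner (char_sum c z) (f z))"
      using inner_char_sum[of c] by (simp add: inner_vec_def)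
    also have "(\<lambda>z. inner (char_sum c z) (f z)) = (\<lambda>z. B * norm (char_sum c z))"
    proof
      fix z show "inner (char_sum c z) (f z) = B * norm (char_sum c z)"
        by (cases "char_sum c z = 0")
           (simp_all add: f_def sgn_div_norm dot_square_norm power2_eq_square)
    qed
    finally have "inner c (coeff f) = B * (LINT z|haar \<Theta>. norm (char_sum c z))" by simp
    then show False using c(2)[of "coeff f"] \<open>f \<in> D\<close> c(3) dual[OF c(1)] by auto
  qed
  then obtain f where f: "f \<in> D" "a = coeff f" by auto
  have norm_f: "Linf_norm (haar \<Theta>) f \<le> ereal B"
    unfolding Linf_norm_def
    by (rule esssup_I) (use f in \<open>auto simp: D_def space_haar intro!: AE_I2\<close>)
  then have "f \<in> Linf (haar \<Theta>)"
    using f by (auto simp: Linf_def D_def)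
  then have "q \<Theta> a \<le> Linf_norm (haar \<Theta>) f"
    unfolding q_def using f by (intro Inf_lower) (auto simp: coeff_def)
  then show ?thesis using norm_f by simp
qed

section \<open>Simple poles on the unit circle\<close>

lemma abel_mean_eventually_zero:
  fixes u :: "nat \<Rightarrow> 'a::banach"
  assumes "\<And>n. n \<ge> N \<Longrightarrow> u n = 0" and r: "r \<longlonglongrightarrow> 1"
  shows "(\<lambda>i. abel_mean u (r i)) \<longlonglongrightarrow> 0"
proof -
  have "abel_mean u s = (1 - s) *\<^sub>R (\<Sum>n<N. s ^ n *\<^sub>R u n)" for s
    unfolding abel_mean_def using assms(1) by (subst suminf_finite[of "{..<N}"]) (auto simp: not_less)
  moreover have "(\<lambda>i. (1 - r i) *\<^sub>R (\<Sum>n<N. r i ^ n *\<^sub>R u n)) \<longlonglongrightarrow> (1 - 1) *\<^sub>R (\<Sum>n<N. 1 ^ n *\<^sub>R u n)"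
    by (intro tendsto_intros r)
  ultimately show ?thesis by simp
qed

text \<open>Evaluate the power series at \<open>r \<zeta>\<close>: there the polar part is exactly \<open>a / (1 - r)\<close>, which the factor
  \<open>1 - r\<close> of the Abel mean turns into \<open>a\<close>, while the holomorphic part is damped to \<open>0\<close>.\<close>

lemma abel_mean_tendsto_pole_coefficient:
  fixes F :: "nat \<Rightarrow> complex" and \<theta> :: real
  defines "\<zeta> \<equiv> exp (- \<i> * of_real \<theta>)"
  assumes U: "open U" "\<zeta> \<in> U" and H: "H holomorphic_on U"
    and polar: "\<And>z. z \<in> U \<Longrightarrow> norm z < 1 \<Longrightarrow> (\<Sum>n. F n * z ^ n) = a / (1 - exp (\<i> * of_real \<theta>) * z) + H z"
    and r: "\<And>i. 0 \<le> r i" "\<And>i. r i < 1" "r \<longlonglongrightarrow> 1"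
  shows "(\<lambda>i. abel_mean (\<lambda>n. F n * \<zeta> ^ n) (r i)) \<longlonglongrightarrow> a"
proof -
  let ?z = "\<lambda>i. of_real (r i) * \<zeta>"
  have unit: "exp (\<i> * of_real \<theta>) * \<zeta> = 1" by (simp add: \<zeta>_def flip: exp_add)
  have norm_z: "norm (?z i) < 1" for i using r(1,2) by (simp add: norm_mult \<zeta>_def)
  have "?z \<longlonglongrightarrow> of_real 1 * \<zeta>" by (intro tendsto_intros r)
  then have z: "?z \<longlonglongrightarrow> \<zeta>" by simp
  have "isCont H \<zeta>"
    using holomorphic_on_imp_continuous_on[OF H] U continuous_on_eq_continuous_at by blast
  then have "(\<lambda>i. H (?z i)) \<longlonglongrightarrow> H \<zeta>" by (rule isCont_tendsto_compose[OF _ z])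
  then have "(\<lambda>i. a + of_real (1 - r i) * H (?z i)) \<longlonglongrightarrow> a + of_real (1 - 1) * H \<zeta>"
    by (intro tendsto_intros r)
  moreover have "\<forall>\<^sub>F i in sequentially. a + of_real (1 - r i) * H (?z i) = abel_mean (\<lambda>n. F n * \<zeta> ^ n) (r i)"
    using topological_tendstoD[OF z U]
  proof eventually_elim
    case (elim i)
    have "abel_mean (\<lambda>n. F n * \<zeta> ^ n) (r i) = of_real (1 - r i) * (\<Sum>n. F n * ?z i ^ n)"
      unfolding abel_mean_def by (simp add: scaleR_conv_of_real power_mult_distrib mult_ac)
    also have "\<dots> = of_real (1 - r i) * (a / (1 - of_real (r i) * (exp (\<i> * of_real \<theta>) * \<zeta>)) + H (?z i))"
      using polar[OF elim norm_z] by (simp add: mult_ac)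
    also have "\<dots> = a + of_real (1 - r i) * H (?z i)"
    proof -
      have "1 - complex_of_real (r i) \<noteq> 0" using r(2)[of i] by (metis eq_iff_diff_eq_0 less_irrefl of_real_eq_1_iff)
      then show ?thesis unfolding unit by (simp add: distrib_left)
    qed
    finally show ?case ..
  qed
  ultimately show ?thesis by (auto intro: Lim_transform_eventually)
qed

lemma residue_pole_coefficient:
  fixes C H :: "complex \<Rightarrow> complex" and \<theta> :: real
  defines "\<zeta> \<equiv> exp (- \<i> * of_real \<theta>)"
  assumes U: "open U" "\<zeta> \<in> U" and H: "H holomorphic_on U"
    and polar: "\<And>z. z \<in> U \<Longrightarrow> z \<noteq> \<zeta> \<Longrightarrow> C z = a / (1 - exp (\<i> * of_real \<theta>) * z) + H z"
  shows "a = - exp (\<i> * of_real \<theta>) * residue C \<zeta>"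
proof -
  have unit: "exp (\<i> * of_real \<theta>) * \<zeta> = 1" by (simp add: \<zeta>_def flip: exp_add)
  \<comment> \<open>The continuation is \<open>?f z / (z - \<zeta>)\<close>, so its residue is the value of the numerator at \<open>\<zeta>\<close>.\<close>
  let ?f = "\<lambda>z. - \<zeta> * a + H z * (z - \<zeta>)"
  have "\<forall>\<^sub>F z in at \<zeta>. z \<in> U \<and> z \<noteq> \<zeta>"
    using eventually_at_topological U by blast
  then have "\<forall>\<^sub>F z in at \<zeta>. C z = ?f z / (z - \<zeta>)"
  proof eventually_elim
    case (elim z)
    have "1 - exp (\<i> * of_real \<theta>) * z = exp (\<i> * of_real \<theta>) * (\<zeta> - z)"
      using unit by (simp add: right_diff_distrib)
    moreover have "\<zeta> = 1 / exp (\<i> * of_real \<theta>)" using unit by (simp add: field_simps)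
    ultimately have "a / (1 - exp (\<i> * of_real \<theta>) * z) = \<zeta> * a / (\<zeta> - z)"
      by simp
    also have "\<dots> = - \<zeta> * a / (z - \<zeta>)"
      using minus_divide_divide[of "\<zeta> * a" "\<zeta> - z"] by simp
    finally show ?case using polar[of z] elim by (simp add: diff_divide_distrib)
  qed
  then have "residue C \<zeta> = residue (\<lambda>z. ?f z / (z - \<zeta>)) \<zeta>"
    by (rule residue_cong) simp
  also have "\<dots> = - \<zeta> * a"
    using residue_simple[OF U, of ?f] H by (simp add: holomorphic_intros)
  finally show ?thesis using unit by (simp add: mult.assoc[symmetric])
qed


section \<open>The lower bound\<close>

theorem corollary34p3:
  fixes \<Theta> :: "real ^ 'm"
    and F :: "nat \<Rightarrow> complex"
    and a :: "complex ^ 'm"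
    and \<zeta> :: "'m \<Rightarrow> complex"
    and U :: "'m \<Rightarrow> complex set"
    and C H :: "'m \<Rightarrow> complex \<Rightarrow> complex"
  assumes distinct_phases: "\<And>i j. i \<noteq> j \<Longrightarrow> \<not> [\<Theta> $ i = \<Theta> $ j] (rmod (2 * pi))"
    and summable: "\<And>r::real. 0 < r \<Longrightarrow> r < 1 \<Longrightarrow> summable (\<lambda>n. norm (F n) * r ^ n)"
    and zeta: "\<And>j. \<zeta> j = exp (- \<i> * of_real (\<Theta> $ j))"
    and nbhd: "\<And>j. open (U j)" "\<And>j. \<zeta> j \<in> U j"
    and continuation: "\<And>j. C j meromorphic_on U j"
      "\<And>j z. z \<in> U j \<Longrightarrow> norm z < 1 \<Longrightarrow> C j z = (\<Sum>n. F n * z ^ n)"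
    and holo: "\<And>j. H j holomorphic_on U j"
    and polar_form: "\<And>j z. z \<in> U j \<Longrightarrow> z \<noteq> \<zeta> j \<Longrightarrow>
        C j z = a $ j / (1 - exp (\<i> * of_real (\<Theta> $ j)) * z) + H j z"
  shows "A_infty_d F \<ge> q \<Theta> a \<and>
    (\<forall>j. a $ j = - exp (\<i> * of_real (\<Theta> $ j)) * residue (C j) (\<zeta> j))"
proof
  show "\<forall>j. a $ j = - exp (\<i> * of_real (\<Theta> $ j)) * residue (C j) (\<zeta> j)"
  proof
    fix j
    show "a $ j = - exp (\<i> * of_real (\<Theta> $ j)) * residue (C j) (\<zeta> j)"
      unfolding zeta
      by (rule residue_pole_coefficient[where U = "U j" and H = "H j"])
         (use nbhd[of j] holo[of j] polar_form[of _ j] in \<open>simp_all add: zeta\<close>)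
  qed
next
  \<comment> \<open>Any sequence of radii increasing to \<open>1\<close> would do.\<close>
  define r where "r = (\<lambda>i. 1 - 1 / real (Suc i))"
  have r: "\<And>i. 0 \<le> r i" "\<And>i. r i < 1" by (auto simp: r_def)
  have "r \<longlonglongrightarrow> 1 - 0" unfolding r_def by (intro tendsto_diff tendsto_const LIMSEQ_Suc[OF lim_1_over_n])
  then have r_lim: "r \<longlonglongrightarrow> 1" by simp
  show "q \<Theta> a \<le> A_infty_d F"
  proof (rule dense_ge)
    fix x assume x: "A_infty_d F < x"
    show "q \<Theta> a \<le> x"
    proof (cases x)
      case PInf
      then show ?thesis by simp
    next
      case MInf
      then show ?thesis using x by simp
    next
      case (real B)
      obtain y where "A_infty_d F < y" "y < ereal B" using dense[of "A_infty_d F" "ereal B"] x real by auto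
      \<comment> \<open>The gap between \<open>B'\<close> and \<open>B\<close> yields the strict inequality that the duality criterion asks for.\<close>
      then obtain B' where B': "A_infty_d F < ereal B'" "B' < B"
        by (cases y) auto
      have "\<forall>\<^sub>F n in sequentially. ereal (norm (F n)) < ereal B'"
        using B'(1) unfolding A_infty_d_def by (rule Limsup_lessD)
      then obtain N where N: "\<And>n. n \<ge> N \<Longrightarrow> norm (F n) \<le> B'"
        by (auto simp: eventually_sequentially intro: less_imp_le)
      have B'_nonneg: "0 \<le> B'" using N[of N] norm_ge_zero[of "F N"] by linarith
      obtain K where K: "\<And>n. norm (F n) \<le> K"
      proof (rule that)
        fix n
        show "norm (F n) \<le> B' + (\<Sum>k<N. norm (F k))"
        proof (cases "n < N")
          case True
          then have "norm (F n) \<le> (\<Sum>k<N. norm (F k))"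
            by (intro member_le_sum) auto
          then show ?thesis using B'_nonneg by simp
        next
          case False
          then show ?thesis using N[of n] sum_nonneg[of "{..<N}" "\<lambda>k. norm (F k)"] by (simp add: add_increasing2)
        qed
      qed
      let ?P = "\<lambda>n. Psi \<Theta> (int n)"
      let ?v = "\<lambda>n. \<chi> j. F n * cnj (?P n $ j)"
      have v_bd: "norm (?v n) \<le> real CARD('m) * K" for n
      proof -
        have "norm (?v n) \<le> (\<Sum>j\<in>UNIV. norm (?v n $ j))" 
          unfolding norm_vec_def by (rule L2_set_le_sum) simp
        also have "\<dots> \<le> real CARD('m) * K"
          using K by (intro sum_bounded_above) (simp add: norm_mult)
        finally show ?thesis .
      qed
      have v_lim: "(\<lambda>i. abel_mean ?v (r i)) \<longlonglongrightarrow> a"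
      proof (rule vec_tendstoI)
        fix j
        have "exp (- \<i> * of_real (\<Theta> $ j)) ^ n = cnj (?P n $ j)" for n
          by (simp add: Psi_def exp_cnj mult_ac flip: exp_of_nat_mult)
        then have "abel_mean ?v (r i) $ j = abel_mean (\<lambda>n. F n * exp (- \<i> * of_real (\<Theta> $ j)) ^ n) (r i)" for i
          using abel_mean_bounded_linear[OF bounded_linear_vec_nth[of j], of ?v, OF v_bd r] by simp
        moreover have "(\<lambda>i. abel_mean (\<lambda>n. F n * exp (- \<i> * of_real (\<Theta> $ j)) ^ n) (r i)) \<longlonglongrightarrow> a $ j"
        proof (rule abel_mean_tendsto_pole_coefficient[where U = "U j" and H = "H j"])
          fix z assume z: "z \<in> U j" "norm z < 1"
          then have "z \<noteq> \<zeta> j" by (auto simp: zeta)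
          then show "(\<Sum>n. F n * z ^ n) = a $ j / (1 - exp (\<i> * of_real (\<Theta> $ j)) * z) + H j z"
            using z continuation(2)[of z j] polar_form[of z j] by simp
        qed (use nbhd[of j] holo[of j] r r_lim in \<open>simp_all add: zeta\<close>)
        ultimately show "(\<lambda>i. abel_mean ?v (r i) $ j) \<longlonglongrightarrow> a $ j" by simp
      qed
      have "q \<Theta> a \<le> ereal B"
      proof (rule q_le_if_dual_bound)
        show "0 \<le> B" using B'_nonneg B'(2) by simp
        fix c :: "complex ^ 'm" assume c: "c \<noteq> 0"
        let ?I = "LINT z|haar \<Theta>. norm (char_sum c z)"
        let ?w = "\<lambda>n. norm (char_sum c (?P n))"
        \<comment> \<open>The finitely many terms with \<open>norm (F n) > B'\<close> are absorbed in \<open>?g\<close>, whose Abel means vanish in the limit.\<close>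
        let ?g = "\<lambda>n. if n < N then K * ?w n else 0"
        define S where "S = (\<Sum>j\<in>UNIV. norm (c $ j))"
        have w: "?w n \<le> S" for n unfolding S_def by (rule norm_char_sum_le[OF Psi_in_G])
        have S_nonneg: "0 \<le> S" by (simp add: S_def sum_nonneg)
        have K_nonneg: "0 \<le> K" using order_trans[OF norm_ge_zero K] .
        have g: "norm (?g n) \<le> K * S" for n
          using w K_nonneg S_nonneg by (auto simp: abs_mult intro: mult_left_mono)
        have B'w: "norm (B' * ?w n) \<le> B' * S" for n
          using w B'_nonneg by (auto simp: abs_mult intro: mult_left_mono)
        have step: "inner c (abel_mean ?v (r i)) \<le> B' * abel_mean ?w (r i) + abel_mean ?g (r i)" for i
        proof -
          have pointwise: "norm (inner c (?v n)) \<le> B' * ?w n + ?g n" for n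
          proof -
            have "norm (inner c (?v n)) \<le> ?w n * norm (F n)"
              unfolding inner_char_sum real_norm_def by (rule Cauchy_Schwarz_ineq2)
            also have "\<dots> \<le> B' * ?w n + ?g n"
            proof (cases "n < N")
              case True
              then show ?thesis
                using mult_left_mono[OF K[of n] norm_ge_zero[of "char_sum c (?P n)"]] B'_nonneg
                by (simp add: mult.commute add_increasing)
            next
              case False
              then show ?thesis
                using mult_left_mono[OF N[of n] norm_ge_zero[of "char_sum c (?P n)"]] by (simp add: mult.commute)
            qed
            finally show ?thesis .
          qed
          have "inner c (abel_mean ?v (r i)) = abel_mean (\<lambda>n. inner c (?v n)) (r i)"
            by (rule abel_mean_bounded_linear[OF bounded_linear_inner_right v_bd r, symmetric])
          also have "\<dots> \<le> abel_mean (\<lambda>n. B' * ?w n + ?g n) (r i)"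
          proof -
            have "B' * ?w n + ?g n \<le> B' * S + K * S" for n
              using B'w[of n] g[of n] unfolding real_norm_def by linarith
            then have "norm (abel_mean (\<lambda>n. inner c (?v n)) (r i)) \<le> abel_mean (\<lambda>n. B' * ?w n + ?g n) (r i)"
              by (intro norm_abel_mean_le pointwise r)
            then show ?thesis by simp
          qed
          also have "\<dots> = abel_mean (\<lambda>n. B' * ?w n) (r i) + abel_mean ?g (r i)"
            by (rule abel_mean_add[OF B'w g r])
          also have "abel_mean (\<lambda>n. B' * ?w n) (r i) = B' * abel_mean ?w (r i)"
            by (rule abel_mean_bounded_linear[OF bounded_linear_mult_right _ r]) (use w in simp)
          finally show ?thesis .
        qed
        have w_lim: "(\<lambda>i. abel_mean ?w (r i)) \<longlonglongrightarrow> ?I"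
          by (rule abel_mean_tendsto_haar_integral)
             (use r r_lim in \<open>auto intro: continuous_on_norm continuous_on_char_sum\<close>)
        have "inner c a \<le> B' * ?I + 0"
        proof (rule LIMSEQ_le)
          show "(\<lambda>i. inner c (abel_mean ?v (r i))) \<longlonglongrightarrow> inner c a"
            by (intro tendsto_intros v_lim)
          show "(\<lambda>i. B' * abel_mean ?w (r i) + abel_mean ?g (r i)) \<longlonglongrightarrow> B' * ?I + 0"
            by (intro tendsto_intros w_lim abel_mean_eventually_zero[OF _ r_lim, of N]) simp
          show "\<exists>N. \<forall>i\<ge>N. inner c (abel_mean ?v (r i)) \<le> B' * abel_mean ?w (r i) + abel_mean ?g (r i)"
            using step by blast
        qed
        moreover have "B' * ?I < B * ?I"
          using L1_norm_char_sum_pos[OF distinct_phases c] B'(2) by simp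
        ultimately show "inner c a < B * ?I" by simp
      qed
      then show ?thesis using real by simp
    qed
  qed
qed

end
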